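(* If $G$ is a finite supersolvable group with $\Phi(G) \cap G' = 1$, then $m(G) = i(G)$. As a corollary, $\mathrm{MaxDim}(G) = m(G)$ for every finite supersolvable group $G$.
   Context: A finite group $G$ is supersolvable if there is a chain of subgroups $1 = G_0 < G_1 < \cdots < G_n = G$ with each $G_i$ normal in $G$ and each quotient $G_{i+1}/G_i$ cyclic. $\Phi(G)$ is the Frattini subgroup (the intersection of all maximal subgroups of $G$) and $G'$ is the commutator subgroup. A finite sequence $(g_1,\dots,g_k)$ of elements of $G$ is generating if $\langle g_1,\dots,g_k\rangle = G$, and irredundant if for every $i$ the subgroup $\langle g_j : j\neq i\rangle$ is properly contained in $\langle g_1,\dots,g_k\rangle$. $m(G)$ is the maximum length of an irredundant generating sequence of $G$; $i(G)$ is the maximum length of any irredundant sequence in $G$ (equivalently, the maximum of $m(H)$ over subgroups $H\le G$). A family of subgroups $(H_i)_{i\in S}$ of $G$ is in general position if for every $i\in S$ the intersection $\bigcap_{j\neq i}H_j$ properly contains $\bigcap_{j\in S}H_j$ (an empty intersection is $G$). $\mathrm{MaxDim}(G)$ is the size of the largest family of maximal subgroups of $G$ in general position. *)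

theory Defs
  imports "HOL-Algebra.Generated_Groups" "HOL-Algebra.Elementary_Groups"
begin

definition supersolvable :: "('a, 'b) monoid_scheme \<Rightarrow> bool" where
  "supersolvable G \<longleftrightarrow> (\<exists>(N :: nat \<Rightarrow> 'a set) n.
     N 0 = {\<one>\<^bsub>G\<^esub>} \<and> N n = carrier G \<and>
     (\<forall>i\<le>n. N i \<lhd> G) \<and>
     (\<forall>i<n. N i \<subset> N (Suc i) \<and> cyclic_group (G\<lparr>carrier := N (Suc i)\<rparr> Mod N i)))"

definition maximal_subgroup :: "'a set \<Rightarrow> ('a, 'b) monoid_scheme \<Rightarrow> bool" where
  "maximal_subgroup M G \<longleftrightarrow> subgroup M G \<and> M \<noteq> carrier G \<and>
     (\<forall>K. subgroup K G \<longrightarrow> M \<subseteq> K \<longrightarrow> K = M \<or> K = carrier G)"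

(* Intersecting with the carrier makes an empty intersection equal to G instead of UNIV;
   for a nonempty family of subgroups it changes nothing. *)
definition subgroup_Inter :: "('a, 'b) monoid_scheme \<Rightarrow> 'a set set \<Rightarrow> 'a set" where
  "subgroup_Inter G \<H> = carrier G \<inter> \<Inter>\<H>"

definition frattini :: "('a, 'b) monoid_scheme \<Rightarrow> 'a set" where
  "frattini G = subgroup_Inter G {M. maximal_subgroup M G}"

(* The index i is omitted, not the value gs ! i: a repeated element is redundant. *)
definition irredundant :: "('a, 'b) monoid_scheme \<Rightarrow> 'a list \<Rightarrow> bool" where
  "irredundant G gs \<longleftrightarrow> set gs \<subseteq> carrier G \<and>
     (\<forall>i<length gs. generate G {gs ! j | j. j < length gs \<and> j \<noteq> i} \<subset> generate G (set gs))"

definition generating :: "('a, 'b) monoid_scheme \<Rightarrow> 'a list \<Rightarrow> bool" where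
  "generating G gs \<longleftrightarrow> set gs \<subseteq> carrier G \<and> generate G (set gs) = carrier G"

(* The invariants m(G), i(G) and MaxDim(G). The lemmas at the end of the theory show that
   for finite G each Max is taken over a finite nonempty set. *)
definition m_max :: "('a, 'b) monoid_scheme \<Rightarrow> nat" where
  "m_max G = Max {length gs | gs. irredundant G gs \<and> generating G gs}"

definition i_max :: "('a, 'b) monoid_scheme \<Rightarrow> nat" where
  "i_max G = Max {length gs | gs. irredundant G gs}"

definition general_position ::
    "('a, 'b) monoid_scheme \<Rightarrow> 'i set \<Rightarrow> ('i \<Rightarrow> 'a set) \<Rightarrow> bool" where
  "general_position G S H \<longleftrightarrow> (\<forall>i\<in>S. subgroup (H i) G) \<and>
     (\<forall>i\<in>S. subgroup_Inter G (H ` S) \<subset> subgroup_Inter G (H ` (S - {i})))"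

definition MaxDim :: "('a, 'b) monoid_scheme \<Rightarrow> nat" where
  "MaxDim G = Max {n. \<exists>H :: nat \<Rightarrow> 'a set.
     (\<forall>i<n. maximal_subgroup (H i) G) \<and> general_position G {..<n} H}"

lemma irredundant_imp_distinct:
  assumes "irredundant G gs"
  shows "distinct gs"
proof (rule ccontr)
  assume "\<not> distinct gs"
  then obtain i k where ik: "i < length gs" "k < length gs" "i \<noteq> k" "gs ! i = gs ! k"
    by (auto simp: distinct_conv_nth)
  have "{gs ! j | j. j < length gs \<and> j \<noteq> i} = set gs"
  proof
    show "set gs \<subseteq> {gs ! j | j. j < length gs \<and> j \<noteq> i}"
    proof
      fix x assume "x \<in> set gs"
      then obtain j where j: "j < length gs" "x = gs ! j" by (auto simp: in_set_conv_nth)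
      show "x \<in> {gs ! j | j. j < length gs \<and> j \<noteq> i}"
        using j ik by (cases "j = i") auto
    qed
  qed auto
  then show False using assms ik(1) unfolding irredundant_def by auto
qed

lemma finite_irredundant_lengths:
  assumes "finite (carrier G)"
  shows "finite {length gs | gs. irredundant G gs}"
proof (rule finite_subset)
  show "{length gs | gs. irredundant G gs} \<subseteq> {..card (carrier G)}"
  proof clarsimp
    fix gs assume "irredundant G gs"
    then have "distinct gs" "set gs \<subseteq> carrier G"
      by (auto simp: irredundant_imp_distinct irredundant_def)
    then show "length gs \<le> card (carrier G)"
      using card_mono[OF assms] distinct_card by metis
  qed
qed simp

lemma irredundant_Nil: "irredundant G []"
  by (simp add: irredundant_def)

lemma (in group) irredundant_generating_exists:
  assumes "finite (carrier G)"
  shows "\<exists>gs. irredundant G gs \<and> generating G gs"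
proof -
  obtain xs where xs: "set xs = carrier G" using finite_list[OF assms] by blast
  then have "generating G xs"
    by (simp add: generating_def generate_incl generate.incl subset_antisym subsetI)
  then obtain gs where gs: "generating G gs"
      and least: "\<And>hs. generating G hs \<Longrightarrow> length gs \<le> length hs"
    using ex_has_least_nat[of "generating G" xs length] by blast
  have "irredundant G gs"
    unfolding irredundant_def
  proof (intro conjI allI impI)
    show carr: "set gs \<subseteq> carrier G" using gs by (simp add: generating_def)
    fix i assume i: "i < length gs"
    let ?hs = "map ((!) gs) (filter (\<lambda>j. j \<noteq> i) [0..<length gs])"
    let ?D = "{gs ! j | j. j < length gs \<and> j \<noteq> i}"
    have D: "set ?hs = ?D" by auto
    have less: "length ?hs < length gs"
      using length_filter_less[of i "[0..<length gs]" "\<lambda>j. j \<noteq> i"] i by simp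
    have sub: "?D \<subseteq> set gs" by auto
    have "generate G ?D \<noteq> carrier G"
    proof
      assume "generate G ?D = carrier G"
      then have "generating G ?hs" using D sub carr by (auto simp: generating_def)
      from least[OF this] show False using less by simp
    qed
    then show "generate G ?D \<subset> generate G (set gs)"
      using mono_generate[OF sub] gs by (auto simp: generating_def)
  qed
  then show ?thesis using gs by blast
qed

lemma finite_MaxDim_set:
  assumes "finite (carrier G)"
  shows "finite {n. \<exists>H :: nat \<Rightarrow> 'a set. (\<forall>i<n. maximal_subgroup (H i) G) \<and>
     general_position (G :: ('a, 'b) monoid_scheme) {..<n} H}"
proof (rule finite_subset)
  show "{n. \<exists>H :: nat \<Rightarrow> 'a set. (\<forall>i<n. maximal_subgroup (H i) G) \<and>
     general_position G {..<n} H} \<subseteq> {..card (Pow (carrier G))}"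
  proof
    fix n
    assume "n \<in> {n. \<exists>H :: nat \<Rightarrow> 'a set. (\<forall>i<n. maximal_subgroup (H i) G) \<and>
      general_position G {..<n} H}"
    then obtain H :: "nat \<Rightarrow> 'a set" where gp: "general_position G {..<n} H"
      by blast
    have "inj_on H {..<n}"
    proof (rule inj_onI, rule ccontr)
      fix i j assume ij: "i \<in> {..<n}" "j \<in> {..<n}" "H i = H j" "i \<noteq> j"
      then have "H ` ({..<n} - {i}) = H ` {..<n}"
        by (metis DiffI image_insert insert_Diff insert_absorb imageI singletonD)
      then show False using gp ij(1) unfolding general_position_def by (metis psubset_eq)
    qed
    moreover have "H ` {..<n} \<subseteq> Pow (carrier G)"
      using gp by (auto simp: general_position_def dest: subgroup.subset)
    ultimately have "card {..<n} \<le> card (Pow (carrier G))"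
      using assms card_inj_on_le[of H "{..<n}" "Pow (carrier G)"] by simp
    then show "n \<in> {..card (Pow (carrier G))}" by simp
  qed
qed simp

lemma zero_in_MaxDim_set:
  "0 \<in> {n. \<exists>H :: nat \<Rightarrow> 'a set. (\<forall>i<n. maximal_subgroup (H i) G) \<and>
     general_position (G :: ('a, 'b) monoid_scheme) {..<n} H}"
  by (simp add: general_position_def)

end

theory Submission
  imports Defs "HOL-Computational_Algebra.Primes" "HOL-Algebra.Multiplicative_Group"
    "HOL-Algebra.Zassenhaus"
begin

text \<open>Write \<open>D\<close> for the commutator subgroup, \<open>\<Phi>\<close> for the Frattini subgroup and \<open>\<Omega>(n)\<close>
for the number of prime factors of \<open>n\<close> counted with multiplicity. Call a set \<open>S\<close> independent
modulo a subgroup \<open>E\<close> if no \<open>s \<in> S\<close> lies in the subgroup generated by \<open>E\<close> and \<open>S - {s}\<close>.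
Both parts follow from one statement (\<open>supersolvable_indep_bound\<close>): in a finite supersolvable
group, a set independent modulo \<open>D \<inter> \<Phi>\<close> is never larger than the largest independent generating
set. If \<open>D \<inter> \<Phi> = 1\<close>, every irredundant sequence is such a set, so \<open>i(G) \<le> m(G)\<close>. For arbitrary
\<open>G\<close>, maximal subgroups \<open>H\<^sub>i\<close> in general position provide elements \<open>g\<^sub>i\<close> that lie in every \<open>H\<^sub>j\<close>
with \<open>j \<noteq> i\<close> but not in \<open>H\<^sub>i\<close>; as \<open>\<Phi>\<close> lies in every \<open>H\<^sub>i\<close>, these are independent modulo
\<open>\<Phi>\<close>, so \<open>MaxDim(G) \<le> m(G)\<close>. The reverse inequalities hold in every finite group.

The upper bound comes from counting. Adding the elements of an independent set one at a time gives
a strictly increasing chain of subgroups, and each step raises \<open>\<Omega>\<close> of the order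
(\<open>indep_mod_chain\<close>). Splitting \<open>S\<close> into a part that stays independent in \<open>G/D\<close> and a rest that
can only enlarge the intersection with \<open>D\<close> yields
\<open>|S| \<le> i(G/D) + \<Omega>(|D|) - \<Omega>(|D \<inter> \<Phi>|)\<close> (\<open>indep_mod_kernel_bound\<close>).

The lower bound uses supersolvability. For a maximal subgroup \<open>M\<close>, the quotient by a suitable normal
subgroup inside \<open>M\<close> has a cyclic normal subgroup that the image of \<open>M\<close> does not contain. Hence
\<open>M\<close> has prime index, and it contains all commutators of elements of \<open>D\<close>, because the commutator
subgroup of a group centralizes every cyclic normal subgroup
(\<open>supersolvable_maximal_subgroup\<close>). Intersecting \<open>D\<close> with the members of a minimal family of
maximal subgroups that cuts \<open>D\<close> down to \<open>D \<inter> \<Phi>\<close> therefore passes through normal subgroups and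
loses one prime at a time. This gives \<open>\<Omega>(|D|) - \<Omega>(|D \<inter> \<Phi>|)\<close> elements of \<open>D\<close> dual to these
maximal subgroups, whose intersection \<open>C\<close> satisfies \<open>C D = G\<close> (\<open>independent_maximal_family\<close>).
Together with lifts to \<open>C\<close> of an independent generating set of \<open>G/D\<close> they form an independent
generating set of \<open>G\<close>, so \<open>m(G) \<ge> m(G/D) + \<Omega>(|D|) - \<Omega>(|D \<inter> \<Phi>|)\<close>.

The two bounds meet once \<open>m = i\<close> is known for the abelian group \<open>A = G/D\<close>. Let \<open>n\<close> be the
product of the primes dividing \<open>|A|\<close>. An independent set generating \<open>B \<le> A\<close> has at most
\<open>\<Omega>(|B|) - \<Omega>(|B\<^sup>n|)\<close> elements. This is \<open>\<Omega>\<close> of the order of the \<open>n\<close>-torsion of \<open>B\<close>, and so at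
most \<open>\<Omega>(|A|) - \<Omega>(|A\<^sup>n|)\<close>. Conversely, \<open>\<Phi>(A) \<le> A\<^sup>n\<close>, and the family of maximal subgroups
built above, with \<open>A\<close> in the role of \<open>D\<close>, gives an independent generating set with
\<open>\<Omega>(|A|) - \<Omega>(|\<Phi>(A)|)\<close> elements.\<close>

section \<open>Prime factors of subgroup orders\<close>

text \<open>The arithmetic function \<open>\<Omega>\<close>. It bounds the length of every chain of subgroups of a group of order \<open>n\<close>.\<close>

definition Omega :: "nat \<Rightarrow> nat" where
  "Omega n = size (prime_factorization n)"

lemma Omega_mult: "a > 0 \<Longrightarrow> b > 0 \<Longrightarrow> Omega (a * b) = Omega a + Omega b"
  by (simp add: Omega_def prime_factorization_mult)

lemma Omega_prime: "prime p \<Longrightarrow> Omega p = 1"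
  by (simp add: Omega_def prime_factorization_prime)

lemma Omega_pos:
  assumes "n > 1"
  shows "Omega n > 0"
proof -
  have "prime_factorization n \<noteq> {#}"
    using assms by (simp add: prime_factorization_empty_iff)
  then show ?thesis
    by (simp add: Omega_def nonempty_has_size)
qed

lemma Omega_strict:
  assumes "a dvd b" "a < b"
  shows "Omega a < Omega b"
proof -
  obtain k where k: "b = a * k" using assms(1) by blast
  then have "a > 0" using assms(2) by (cases "a = 0") auto
  moreover have "k > 1" using assms(2) k by (cases "k = 0"; cases "k = 1") auto
  ultimately show ?thesis
    using k Omega_mult[of a k] Omega_pos[of k] by simp
qed

lemma (in group) card_subgroup_pos:
  assumes "finite (carrier G)" "subgroup H G"
  shows "card H > 0"
  using assms by (simp add: subgroup.finite_imp_card_positive)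

lemma (in group) finite_subgroup:
  assumes "finite (carrier G)" "subgroup H G"
  shows "finite H"
  using assms by (meson finite_subset subgroup.subset)

lemma (in group) card_subgroup_dvd:
  assumes "subgroup H G" "subgroup K G" "H \<subseteq> K"
  shows "card H dvd card K"
proof -
  interpret K: group "G\<lparr>carrier := K\<rparr>" using assms(2) by (simp add: subgroup_imp_group)
  have "subgroup H (G\<lparr>carrier := K\<rparr>)"
    using assms by (simp add: subgroup_incl)
  from K.lagrange[OF this] have "card (rcosets\<^bsub>G\<lparr>carrier := K\<rparr>\<^esub> H) * card H = card K"
    by (simp add: order_def)
  then show ?thesis by (metis dvd_triv_right)
qed

lemma (in group) Omega_subgroup_strict:
  assumes "finite (carrier G)" "subgroup H G" "subgroup K G" "H \<subset> K"
  shows "Omega (card H) < Omega (card K)"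
  by (rule Omega_strict[OF card_subgroup_dvd psubset_card_mono])
    (use assms finite_subgroup[of K] in auto)

lemma (in group) Omega_subgroup_mono:
  assumes "finite (carrier G)" "subgroup H G" "subgroup K G" "H \<subseteq> K"
  shows "Omega (card H) \<le> Omega (card K)"
  using assms Omega_subgroup_strict[of H K] by (cases "H = K") (auto simp: psubset_eq)

text \<open>All fibres of \<open>h\<close> on \<open>K\<close> are translates of the kernel of the restriction. The lemma serves for
coset maps \<open>G \<rightarrow> G/N\<close> and for power maps of abelian groups.\<close>

lemma (in group_hom) card_subgroup_image_kernel:
  assumes "finite (carrier G)" "subgroup K G"
  shows "card K = card (h ` K) * card (K \<inter> kernel G H h)"
proof -
  interpret K: subgroup K G by fact
  have fin: "finite K" using assms by (rule G.finite_subgroup)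
  have fibre: "card {x \<in> K. h x = y} = card (K \<inter> kernel G H h)" if y: "y \<in> h ` K" for y
  proof -
    obtain x0 where x0: "x0 \<in> K" "y = h x0" using y by blast
    have "bij_betw (\<lambda>k. k \<otimes> x0) (K \<inter> kernel G H h) {x \<in> K. h x = y}"
    proof (rule bij_betwI[where g = "\<lambda>x. x \<otimes> inv x0"])
      show "(\<lambda>k. k \<otimes> x0) \<in> K \<inter> kernel G H h \<rightarrow> {x \<in> K. h x = y}"
        using x0 by (auto simp: kernel_def)
      show "(\<lambda>x. x \<otimes> inv x0) \<in> {x \<in> K. h x = y} \<rightarrow> K \<inter> kernel G H h"
        using x0 by (auto simp: kernel_def)
    qed (use x0 in \<open>auto simp: G.m_assoc\<close>)
    then show ?thesis by (simp add: bij_betw_same_card)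
  qed
  have "card K = (\<Sum>x\<in>K. 1)" by simp
  also have "\<dots> = (\<Sum>y\<in>h ` K. \<Sum>x\<in>{x \<in> K. h x = y}. 1)"
    by (rule sum.image_gen[OF fin])
  also have "\<dots> = (\<Sum>y\<in>h ` K. card (K \<inter> kernel G H h))"
    by (intro sum.cong) (simp_all add: fibre)
  finally show ?thesis by simp
qed

section \<open>Independence modulo a subgroup\<close>

text \<open>The union with \<open>E\<close> makes one notion cover irredundance (\<open>E = {}\<close>) and irredundance in the
presence of the Frattini subgroup, whose elements belong to all maximal subgroups anyway.\<close>

definition indep_mod :: "('a, 'b) monoid_scheme \<Rightarrow> 'a set \<Rightarrow> 'a set \<Rightarrow> bool" where
  "indep_mod G E S \<longleftrightarrow> (\<forall>s\<in>S. s \<notin> generate G (E \<union> (S - {s})))"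

text \<open>Adjoining the elements of \<open>S - T\<close> one after another gives a chain of subgroups, and independence
makes every inclusion strict. By Lagrange each step gains at least one prime factor.\<close>

lemma (in group) indep_mod_chain:
  assumes fin: "finite (carrier G)" and E: "E \<subseteq> carrier G" and S: "S \<subseteq> carrier G"
    and ind: "indep_mod G E S" and T: "T \<subseteq> S"
  shows "Omega (card (generate G (E \<union> T))) + card (S - T) \<le> Omega (card (generate G (E \<union> S)))"
proof -
  have "Omega (card (generate G (E \<union> T))) + card R \<le> Omega (card (generate G (E \<union> (T \<union> R))))"
    if "finite R" "R \<subseteq> S - T" for R
    using that
  proof (induction R)
    case (insert r R)
    let ?L = "generate G (E \<union> (T \<union> R))" and ?L' = "generate G (E \<union> (T \<union> insert r R))"
    have sub: "E \<union> (T \<union> insert r R) \<subseteq> carrier G" using E S T insert.prems by blast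
    have "r \<notin> generate G (E \<union> (S - {r}))" using ind insert.prems by (auto simp: indep_mod_def)
    moreover have "E \<union> (T \<union> R) \<subseteq> E \<union> (S - {r})"
      using T insert.prems insert.hyps by blast
    ultimately have "r \<notin> ?L" using mono_generate by blast
    moreover have "r \<in> ?L'" by (simp add: generate.incl)
    moreover have "?L \<subseteq> ?L'" by (rule mono_generate) blast
    ultimately have "?L \<subset> ?L'" by blast
    then have "Omega (card ?L) < Omega (card ?L')"
      using sub by (intro Omega_subgroup_strict[OF fin] generate_is_subgroup) auto
    then show ?case using insert by simp
  qed simp
  from this[of "S - T"] show ?thesis
    using T finite_subset[OF S fin] by (simp add: Un_Diff_cancel Un_absorb1)
qed

lemma (in group_hom) subgroup_vimage:
  assumes "subgroup K H"
  shows "subgroup {x \<in> carrier G. h x \<in> K} G"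
proof (rule G.subgroupI)
  show "{x \<in> carrier G. h x \<in> K} \<noteq> {}"
    using subgroup.one_closed[OF assms] by (intro ex_in_conv[THEN iffD1] exI[of _ "\<one>"]) simp
qed (use assms in \<open>auto intro: subgroup.m_closed subgroup.m_inv_closed\<close>)

text \<open>An independent set loses at most \<open>\<Omega>(|D|) - \<Omega>(|E|)\<close> elements when it is mapped to a quotient by
\<open>D\<close>. Choose \<open>T \<subseteq> S\<close> minimal such that \<open>T\<close> and \<open>D\<close> generate everything in \<open>S\<close>: minimality makes
the image of \<open>T\<close> independent. The subgroups \<open>K \<le> B\<close> generated by \<open>E\<close> with \<open>T\<close> and with \<open>S\<close> have
the same image, so the chain from \<open>K\<close> to \<open>B\<close>, of length at least \<open>|S - T|\<close>, is visible in their
intersections with \<open>D\<close>, which lie between \<open>E\<close> and \<open>D\<close>.\<close>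

lemma (in group_hom) indep_mod_kernel_bound:
  assumes fin: "finite (carrier G)" and S: "S \<subseteq> carrier G"
    and E: "subgroup E G" "E \<subseteq> kernel G H h" and ind: "indep_mod G E S"
  shows "\<exists>U\<subseteq>carrier H. indep_mod H {} U \<and>
           card S + Omega (card E) \<le> card U + Omega (card (kernel G H h))"
proof -
  let ?D = "kernel G H h"
  have D: "subgroup ?D G" by (rule subgroup_kernel)
  then have Dc: "?D \<subseteq> carrier G" by (rule subgroup.subset)
  have Ec: "E \<subseteq> carrier G" using E Dc by blast
  have finS: "finite S" using S fin by (rule finite_subset)
  have gen: "S \<subseteq> generate G (?D \<union> S)" by (auto intro: generate.incl)
  define P where "P T \<longleftrightarrow> T \<subseteq> S \<and> S \<subseteq> generate G (?D \<union> T)" for T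
  have "P S" using gen by (simp add: P_def)
  then obtain T where "P T" and lP: "\<And>T'. P T' \<Longrightarrow> card T \<le> card T'"
    using ex_has_least_nat[of P S card] by metis
  then have T: "T \<subseteq> S" "S \<subseteq> generate G (?D \<union> T)"
    and least: "\<And>T'. T' \<subseteq> S \<Longrightarrow> S \<subseteq> generate G (?D \<union> T') \<Longrightarrow> card T \<le> card T'"
    by (simp_all add: P_def)
  have Tc: "T \<subseteq> carrier G" using T(1) S by blast
  have finT: "finite T" using T(1) finS by (rule finite_subset)
  have indT: "t \<notin> generate G (?D \<union> (T - {t}))" if t: "t \<in> T" for t
  proof
    let ?L = "generate G (?D \<union> (T - {t}))"
    assume *: "t \<in> ?L"
    have sg: "subgroup ?L G" using Dc Tc by (intro G.generate_is_subgroup) blast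
    have "?D \<union> T \<subseteq> ?L" using * by (auto intro: generate.incl)
    then have "generate G (?D \<union> T) \<subseteq> ?L" using sg by (rule G.generate_subgroup_incl)
    then have "S \<subseteq> ?L" using T by blast
    then have "card T \<le> card (T - {t})" using T by (intro least) auto
    then show False using t finT by (meson card_Diff1_less not_le)
  qed
  have lift: "t \<in> generate G (?D \<union> R)" if t: "t \<in> carrier G" and R: "R \<subseteq> carrier G"
    and ht: "h t \<in> generate H (h ` R)" for t R
  proof -
    have "h t \<in> h ` generate G R" using ht R generate_img by blast
    then obtain r where r: "r \<in> generate G R" "h t = h r" by blast
    have rc: "r \<in> carrier G" using r R G.generate_incl by blast
    have "t \<otimes> inv r \<in> ?D" using t rc r by (simp add: kernel_def)
    then have "t \<otimes> inv r \<in> generate G (?D \<union> R)" by (simp add: generate.incl)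
    moreover have "r \<in> generate G (?D \<union> R)" using r G.mono_generate[of R "?D \<union> R"] by blast
    ultimately have "t \<otimes> inv r \<otimes> r \<in> generate G (?D \<union> R)" by (rule generate.eng)
    then show ?thesis using t rc by (simp add: G.m_assoc)
  qed
  have inj: "inj_on h T"
  proof (rule inj_onI, rule ccontr)
    fix t u assume *: "t \<in> T" "u \<in> T" "h t = h u" "t \<noteq> u"
    then have "h t \<in> generate H (h ` (T - {t}))" by (auto intro!: generate.incl)
    then show False using lift[of t "T - {t}"] indT[of t] * Tc by blast
  qed
  have "indep_mod H {} (h ` T)"
    unfolding indep_mod_def
  proof clarsimp
    fix t assume t: "t \<in> T" "h t \<in> generate H (h ` T - {h t})"
    moreover have "h ` T - {h t} = h ` (T - {t})" using inj t(1) by (auto simp: inj_on_def)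
    ultimately show False using lift[of t "T - {t}"] indT[of t] Tc by auto
  qed
  moreover have "h ` T \<subseteq> carrier H" using Tc by auto
  moreover have "card (h ` T) = card T" using inj by (rule card_image)
  moreover have "card S + Omega (card E) \<le> card T + Omega (card ?D)"
  proof -
    let ?B = "generate G (E \<union> S)" and ?K = "generate G (E \<union> T)"
    have B: "subgroup ?B G" and K: "subgroup ?K G"
      using Ec S Tc by (auto intro: G.generate_is_subgroup)
    have KB: "?K \<subseteq> ?B" using T by (intro G.mono_generate) blast
    have "card (S - T) = card S - card T" "card T \<le> card S"
      using T finT finS by (auto simp: card_Diff_subset card_mono)
    then have 1: "Omega (card ?K) + card S \<le> Omega (card ?B) + card T"
      using G.indep_mod_chain[OF fin Ec S ind T(1)] by linarith
    have "?B \<subseteq> {x \<in> carrier G. h x \<in> h ` ?K}"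
    proof (rule G.generate_subgroup_incl)
      have hK: "subgroup (h ` ?K) H" using K by (rule subgroup_img_is_subgroup)
      show sg: "subgroup {x \<in> carrier G. h x \<in> h ` ?K} G"
        using hK by (rule subgroup_vimage)
      have "?D \<union> T \<subseteq> {x \<in> carrier G. h x \<in> h ` ?K}"
      proof
        fix x assume "x \<in> ?D \<union> T"
        then show "x \<in> {x \<in> carrier G. h x \<in> h ` ?K}"
        proof
          assume "x \<in> ?D"
          then show ?thesis using subgroup.one_closed[OF hK] by (simp add: kernel_def)
        next
          assume "x \<in> T"
          then have "x \<in> ?K" by (simp add: generate.incl)
          then show ?thesis using \<open>x \<in> T\<close> Tc by blast
        qed
      qed
      then have "generate G (?D \<union> T) \<subseteq> {x \<in> carrier G. h x \<in> h ` ?K}"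
        using sg by (rule G.generate_subgroup_incl)
      moreover have "E \<subseteq> generate G (?D \<union> T)" using E by (auto intro: generate.incl)
      ultimately show "E \<union> S \<subseteq> {x \<in> carrier G. h x \<in> h ` ?K}" using T by blast
    qed
    then have "h ` ?B = h ` ?K" using KB by blast
    moreover have BD: "subgroup (?B \<inter> ?D) G" and KD: "subgroup (?K \<inter> ?D) G"
      using B K D by (auto intro: G.subgroups_Inter_pair)
    ultimately have "Omega (card ?B) + Omega (card (?K \<inter> ?D))
        = Omega (card ?K) + Omega (card (?B \<inter> ?D))"
      using card_subgroup_image_kernel[OF fin B] card_subgroup_image_kernel[OF fin K]
        G.card_subgroup_pos[OF fin B] G.card_subgroup_pos[OF fin K] by (simp add: Omega_mult)
    moreover have "Omega (card (?B \<inter> ?D)) \<le> Omega (card ?D)"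
      using BD D by (intro G.Omega_subgroup_mono[OF fin]) auto
    moreover have "Omega (card E) \<le> Omega (card (?K \<inter> ?D))"
      using KD E by (intro G.Omega_subgroup_mono[OF fin]) (auto intro: generate.incl)
    ultimately show ?thesis using 1 by linarith
  qed
  ultimately show ?thesis by (intro exI[of _ "h ` T"]) auto
qed

section \<open>Independent sets in abelian groups\<close>

lemma (in group) set_mult_absorbs:
  assumes "subgroup H G" "subgroup K G"
  shows "H \<subseteq> H <#> K" "K \<subseteq> H <#> K"
proof -
  have "x \<otimes> \<one> \<in> H <#> K" if "x \<in> H" for x
    unfolding set_mult_def using that subgroup.one_closed[OF assms(2)] by blast
  then show "H \<subseteq> H <#> K" using subgroup.mem_carrier[OF assms(1)] by fastforce
  have "\<one> \<otimes> x \<in> H <#> K" if "x \<in> K" for x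
    unfolding set_mult_def using that subgroup.one_closed[OF assms(1)] by blast
  then show "K \<subseteq> H <#> K" using subgroup.mem_carrier[OF assms(2)] by fastforce
qed

text \<open>The exponents \<open>j\<close> with \<open>x\<close> to the power \<open>j\<close> in \<open>K\<close> form an ideal of the integers, which is nonzero
as it contains the group order.\<close>

lemma (in group) power_mem_subgroup_iff:
  assumes fin: "finite (carrier G)" and K: "subgroup K G" and x: "x \<in> carrier G"
  obtains k :: nat where "k > 0" "k dvd order G" "\<And>j::int. x [^] j \<in> K \<longleftrightarrow> int k dvd j"
proof -
  define P where "P k \<longleftrightarrow> 0 < k \<and> x [^] k \<in> K" for k :: nat
  have "P (order G)"
    using fin x subgroup.one_closed[OF K] by (simp add: P_def pow_order_eq_1 order_gt_0_iff_finite)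
  define k where "k = (LEAST k. P k)"
  have k: "P k" unfolding k_def using \<open>P (order G)\<close> by (rule LeastI)
  have least: "\<not> P r" if "r < k" for r using that not_less_Least unfolding k_def by blast
  have mult: "x [^] (int k * q) \<in> K" for q
    using subgroup_int_pow_closed[OF K, of "x [^] k" q] k x
    by (simp add: P_def int_pow_pow flip: int_pow_int)
  have iff: "x [^] j \<in> K \<longleftrightarrow> int k dvd j" for j :: int
  proof
    assume "x [^] j \<in> K"
    then have "x [^] j \<otimes> inv (x [^] (int k * (j div int k))) \<in> K"
      using mult K by (intro subgroup.m_closed subgroup.m_inv_closed)
    then have "x [^] (j - int k * (j div int k)) \<in> K" using x by (simp add: int_pow_diff)
    then have "x [^] (j mod int k) \<in> K" by (simp add: minus_mult_div_eq_mod)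
    moreover have "j mod int k = int (nat (j mod int k))" "nat (j mod int k) < k"
      using k by (auto simp: P_def nat_less_iff)
    ultimately have "nat (j mod int k) = 0"
      using least[of "nat (j mod int k)"] by (metis P_def gr0I int_pow_int)
    then show "int k dvd j" using k by (auto simp: P_def dvd_eq_mod_eq_0 intro: antisym)
  next
    assume "int k dvd j" then show "x [^] j \<in> K" using mult by (auto elim: dvdE)
  qed
  have "x [^] int (order G) \<in> K" using \<open>P (order G)\<close> by (simp add: P_def int_pow_int)
  then have "k dvd order G" unfolding iff by simp
  then show ?thesis using that[of k] k iff by (simp add: P_def)
qed

text \<open>Replacing \<open>x\<close> by a suitable power makes the generator of the exponent ideal prime. The power
\<open>x [^] int k\<close> is then outside \<open>K\<close> while its \<open>p\<close>-th power is inside.\<close>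

lemma (in group) prime_power_mem_subgroup_iff:
  assumes fin: "finite (carrier G)" and K: "subgroup K G" and x: "x \<in> carrier G" "x \<notin> K"
  obtains p k :: nat where "prime p" "p dvd order G"
    "\<And>j::int. (x [^] int k) [^] j \<in> K \<longleftrightarrow> int p dvd j"
proof -
  obtain k where k: "k > 0" "k dvd order G" "\<And>j::int. x [^] j \<in> K \<longleftrightarrow> int k dvd j"
    using power_mem_subgroup_iff[OF fin K x(1)] by blast
  have "k \<noteq> 1" using k(3)[of 1] x by auto
  then obtain p where p: "prime p" "p dvd k" using prime_factor_nat by blast
  then obtain k' where k': "k = p * k'" by blast
  show ?thesis
  proof (rule that[of p k'])
    show "p dvd order G" using p k(2) by (meson dvd_trans)
    show "(x [^] int k') [^] j \<in> K \<longleftrightarrow> int p dvd j" for j :: int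
      using k(1) x by (simp add: int_pow_pow k(3) k' mult.commute)
  qed (use p in simp)
qed

lemma (in comm_group) pow_group_hom: "group_hom G G (\<lambda>x. x [^] (n::nat))"
  by unfold_locales (auto simp: hom_def nat_pow_distrib)

text \<open>Let \<open>B\<close> be generated by \<open>S\<close> and \<open>K\<close> by \<open>S - {s}\<close>. If \<open>p\<close> is a prime divisor of the order of \<open>s\<close>
modulo \<open>K\<close>, then \<open>K\<close> and the \<open>p\<close>-th power of \<open>s\<close> generate a subgroup \<open>W\<close> of index \<open>p\<close> in \<open>B\<close>. As
\<open>p\<close> divides \<open>n\<close>, all \<open>n\<close>-th powers of elements of \<open>B\<close> belong to \<open>W\<close>, whereas \<open>s\<close> does not.\<close>

lemma (in comm_group) indep_mod_powers:
  fixes n :: nat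
  assumes fin: "finite (carrier G)" and S: "S \<subseteq> carrier G" and ind: "indep_mod G {} S"
    and n: "\<And>p. prime p \<Longrightarrow> p dvd order G \<Longrightarrow> p dvd n"
  shows "indep_mod G ((\<lambda>x. x [^] n) ` generate G S) S"
  unfolding indep_mod_def
proof
  fix s assume s: "s \<in> S"
  then have sc: "s \<in> carrier G" using S by blast
  let ?K = "generate G (S - {s})"
  have K: "subgroup ?K G" using S by (intro generate_is_subgroup) blast
  have Kc: "?K \<subseteq> carrier G" using K by (rule subgroup.subset)
  have "s \<notin> ?K" using ind s by (simp add: indep_mod_def)
  obtain k where k: "k > 0" "k dvd order G" "\<And>j::int. s [^] j \<in> ?K \<longleftrightarrow> int k dvd j"
    using power_mem_subgroup_iff[OF fin K sc] by blast
  have "k \<noteq> 1" using k(3)[of 1] \<open>s \<notin> ?K\<close> sc by auto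
  then obtain p where p: "prime p" "p dvd k" using prime_factor_nat by blast
  then have "p dvd n" using n k(2) by (meson dvd_trans)
  then obtain n' where n': "n = p * n'" by blast
  let ?W = "?K <#> generate G {s [^] int p}"
  have W: "subgroup ?W G" using sc by (intro mult_subgroups[OF K] generate_is_subgroup) auto
  have KW: "?K \<subseteq> ?W" using sc by (intro set_mult_absorbs(1)[OF K] generate_is_subgroup) simp
  have sW: "s \<notin> ?W"
  proof
    assume "s \<in> ?W"
    then obtain \<kappa> w where \<kappa>: "\<kappa> \<in> ?K" "w \<in> generate G {s [^] int p}" "s = \<kappa> \<otimes> w"
      unfolding set_mult_def by blast
    have "generate G {s [^] int p} = {(s [^] int p) [^] j |j::int. j \<in> UNIV}"
      using sc by (intro generate_pow) simp
    then obtain j where j: "w = (s [^] int p) [^] (j::int)" using \<kappa>(2) by blast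
    note * = \<kappa>(1) \<kappa>(3)[unfolded j]
    then have "\<kappa> = s \<otimes> inv (s [^] (int p * j))" using sc Kc
      by (metis int_pow_closed int_pow_pow inv_solve_right subsetD)
    also have "\<dots> = s [^] (1 - int p * j)" using sc by (simp add: int_pow_diff)
    \<comment> \<open>\<open>\<kappa>\<close> is a power of \<open>s\<close> lying in \<open>K\<close>, so its exponent is a multiple of \<open>k\<close> and hence of \<open>p\<close>.\<close>
    finally have "int k dvd 1 - int p * j" using *(1) k(3) by metis
    then have "int p dvd 1 - int p * j" using p(2) by (meson dvd_trans int_dvd_int_iff)
    then have "int p dvd 1" by (metis dvd_diff_commute dvd_triv_left dvd_diff diff_add_cancel dvd_add)
    then show False using p(1) not_prime_unit by auto
  qed
  have "generate G S \<subseteq> ?K <#> generate G {s}"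
  proof (rule generate_subgroup_incl)
    show "subgroup (?K <#> generate G {s}) G"
      using sc by (intro mult_subgroups[OF K] generate_is_subgroup) auto
    have "generate G {s} \<subseteq> ?K <#> generate G {s}" "?K \<subseteq> ?K <#> generate G {s}"
      using sc by (intro set_mult_absorbs[OF K] generate_is_subgroup; simp)+
    moreover have "s \<in> generate G {s}" "S - {s} \<subseteq> ?K" by (auto intro: generate.incl)
    ultimately show "S \<subseteq> ?K <#> generate G {s}" by blast
  qed
  then have "(\<lambda>x. x [^] n) ` generate G S \<subseteq> ?W"
  proof (rule_tac image_subsetI)
    fix b assume "generate G S \<subseteq> ?K <#> generate G {s}" "b \<in> generate G S"
    then obtain \<kappa> j where b: "\<kappa> \<in> ?K" "b = \<kappa> \<otimes> s [^] (j::int)"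
      using sc by (force simp: set_mult_def generate_pow)
    have "(s [^] j) [^] n = (s [^] j) [^] int n" by (simp add: int_pow_int)
    also have "\<dots> = (s [^] int p) [^] (j * int n')"
      using sc by (simp add: int_pow_pow n' algebra_simps)
    finally have "b [^] n = \<kappa> [^] n \<otimes> (s [^] int p) [^] (j * int n')"
      using b Kc sc by (simp add: nat_pow_distrib subsetD)
    moreover have "\<kappa> [^] n \<in> ?K"
      using subgroup_int_pow_closed[OF K b(1), of "int n"] by (simp add: int_pow_int)
    ultimately show "b [^] n \<in> ?W"
      using sc by (auto simp: set_mult_def generate_pow)
  qed
  moreover have "S - {s} \<subseteq> ?W" using KW by (auto intro: generate.incl)
  ultimately have "generate G ((\<lambda>x. x [^] n) ` generate G S \<union> (S - {s})) \<subseteq> ?W"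
    using W by (intro generate_subgroup_incl) auto
  then show "s \<notin> generate G ((\<lambda>x. x [^] n) ` generate G S \<union> (S - {s}))" using sW by blast
qed

text \<open>The set \<open>S\<close> is independent modulo the \<open>n\<close>-th powers of the subgroup \<open>B\<close> it generates, so it has at
most \<open>\<Omega>(|B|) - \<Omega>(|B\<^sup>n|)\<close> elements. This difference is not obviously monotone in \<open>B\<close>, but by the
homomorphism theorem for \<open>x \<mapsto> x\<^sup>n\<close> it equals \<open>\<Omega>\<close> of the order of the \<open>n\<close>-torsion subgroup of
\<open>B\<close>, which is contained in that of \<open>G\<close>.\<close>

lemma (in comm_group) indep_card_bound:
  fixes n :: nat
  assumes fin: "finite (carrier G)" and S: "S \<subseteq> carrier G" and ind: "indep_mod G {} S"
    and n: "\<And>p. prime p \<Longrightarrow> p dvd order G \<Longrightarrow> p dvd n"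
  shows "card S + Omega (card ((\<lambda>x. x [^] n) ` carrier G)) \<le> Omega (card (carrier G))"
proof -
  let ?f = "\<lambda>x. x [^] n"
  let ?B = "generate G S"
  interpret f: group_hom G G ?f by (rule pow_group_hom)
  have B: "subgroup ?B G" using S by (rule generate_is_subgroup)
  have fB: "subgroup (?f ` ?B) G" using B by (rule f.subgroup_img_is_subgroup)
  have fBB: "?f ` ?B \<subseteq> ?B"
    using subgroup_int_pow_closed[OF B, of _ "int n"] by (auto simp: int_pow_int)
  have "Omega (card (generate G (?f ` ?B \<union> {}))) + card (S - {}) \<le> Omega (card (generate G (?f ` ?B \<union> S)))"
    using S fBB subgroup.subset[OF B]
    by (intro indep_mod_chain[OF fin] indep_mod_powers[OF fin S ind n]) auto
  moreover have "generate G (?f ` ?B \<union> {}) = ?f ` ?B"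
    using fB generate_subgroup_incl[of "?f ` ?B" "?f ` ?B"] generate.incl[of _ "?f ` ?B" G] by auto
  moreover have "Omega (card (generate G (?f ` ?B \<union> S))) \<le> Omega (card ?B)"
  proof (rule Omega_subgroup_mono[OF fin _ B])
    show "generate G (?f ` ?B \<union> S) \<subseteq> ?B"
      using B fBB generate.incl[of _ S G] by (intro generate_subgroup_incl) auto
    show "subgroup (generate G (?f ` ?B \<union> S)) G"
      using S fBB subgroup.subset[OF B] by (intro generate_is_subgroup) auto
  qed
  ultimately have 1: "Omega (card (?f ` ?B)) + card S \<le> Omega (card ?B)" by simp
  have tors: "Omega (card K) = Omega (card (?f ` K)) + Omega (card (K \<inter> kernel G G ?f))"
    if "subgroup K G" for K
    using f.card_subgroup_image_kernel[OF fin that] card_subgroup_pos[OF fin that]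
    by (simp add: Omega_mult)
  have "Omega (card (?B \<inter> kernel G G ?f)) \<le> Omega (card (carrier G \<inter> kernel G G ?f))"
    using B subgroup.subset[OF B] f.subgroup_kernel subgroup_self
    by (intro Omega_subgroup_mono[OF fin] subgroups_Inter_pair) auto
  then show ?thesis using 1 tors[OF B] tors[OF subgroup_self] by linarith
qed

text \<open>For squarefree \<open>n\<close> the quotient by the \<open>n\<close>-th powers is a product of elementary abelian groups, so
its maximal subgroups intersect trivially. Take \<open>M\<close> maximal among the subgroups that contain the
\<open>n\<close>-th powers and avoid \<open>x\<close>, and a power \<open>c\<close> of \<open>x\<close> outside \<open>M\<close> with \<open>c\<^sup>p \<in> M\<close>. Every subgroup
properly above \<open>M\<close> contains \<open>x\<close>, hence \<open>c\<close>. It remains to see that \<open>M\<close> and \<open>c\<close> generate the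
whole group: for \<open>y \<notin> M\<close> the element \<open>c\<close> is a power \<open>y [^] a\<close> modulo \<open>M\<close>, and \<open>y\<close> has order \<open>p\<close>
modulo \<open>M\<close>, so that \<open>a\<close> can be inverted modulo \<open>p\<close>.\<close>

lemma (in comm_group) maximal_subgroup_avoiding:
  fixes n :: nat
  assumes fin: "finite (carrier G)" and x: "x \<in> carrier G" "x \<notin> (\<lambda>y. y [^] n) ` carrier G"
    and n: "\<And>p. prime p \<Longrightarrow> \<not> p * p dvd n"
  shows "\<exists>M. maximal_subgroup M G \<and> x \<notin> M"
proof -
  let ?f = "\<lambda>y. y [^] n"
  interpret f: group_hom G G ?f by (rule pow_group_hom)
  let ?\<M> = "{M. subgroup M G \<and> ?f ` carrier G \<subseteq> M \<and> x \<notin> M}"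
  have "finite ?\<M>" using fin by (rule_tac finite_subset[of _ "Pow (carrier G)"]) (auto dest: subgroup.subset)
  moreover have "?f ` carrier G \<in> ?\<M>" using x f.img_is_subgroup by simp
  ultimately obtain M where M: "M \<in> ?\<M>" and Mmax: "\<And>K. K \<in> ?\<M> \<Longrightarrow> M \<subseteq> K \<Longrightarrow> K = M"
    using finite_has_maximal[of ?\<M>] by (metis (no_types, lifting) empty_iff)
  have sgM: "subgroup M G" and fM: "?f ` carrier G \<subseteq> M" and xM: "x \<notin> M" using M by auto
  have Mc: "M \<subseteq> carrier G" using sgM by (rule subgroup.subset)
  obtain p k :: nat where p: "prime p" and cM: "\<And>j::int. (x [^] int k) [^] j \<in> M \<longleftrightarrow> int p dvd j"
    using prime_power_mem_subgroup_iff[OF fin sgM x(1) xM] by metis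
  define c where "c = x [^] int k"
  have c: "c \<in> carrier G" using x by (simp add: c_def)
  have cM: "c [^] (j::int) \<in> M \<longleftrightarrow> int p dvd j" for j using cM by (simp add: c_def)
  have "c [^] int n \<in> M" using fM c by (auto simp: int_pow_int)
  then have "p dvd n" by (simp add: cM)
  then obtain n' where n': "n = p * n'" by blast
  then have pn': "\<not> p dvd n'" using n[OF p] by auto
  have above: "c \<in> K" if K: "subgroup K G" "M \<subset> K" for K
  proof -
    have "x \<in> K" using K Mmax[of K] fM by auto
    then show ?thesis unfolding c_def using K by (simp add: subgroup_int_pow_closed)
  qed
  have split: "\<exists>m\<in>M. \<exists>a::int. c = m \<otimes> y [^] a" if y: "y \<in> carrier G" "y \<notin> M" for y
  proof -
    let ?K = "M <#> generate G {y}"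
    have "subgroup ?K G" using sgM y by (intro mult_subgroups generate_is_subgroup) auto
    moreover have "M \<subseteq> ?K" "generate G {y} \<subseteq> ?K"
      using y by (intro set_mult_absorbs[OF sgM] generate_is_subgroup; simp)+
    moreover have "y \<in> generate G {y}" by (simp add: generate.incl)
    ultimately have "c \<in> ?K" using y by (intro above) auto
    then show ?thesis using y by (auto simp: set_mult_def generate_pow)
  qed
  have gen: "y \<in> K" if y: "y \<in> carrier G" and K: "subgroup K G" "M \<subset> K" for y K
  proof (cases "y \<in> M")
    case False
    \<comment> \<open>If \<open>y [^] p\<close> were outside \<open>M\<close>, then \<open>c\<close> would be a power of it modulo \<open>M\<close>, which
      \<open>n' = n / p\<close> kills; but \<open>c\<close> has order \<open>p\<close> modulo \<open>M\<close>, and \<open>p\<close> does not divide \<open>n'\<close>.\<close>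
    have pM: "y [^] int p \<in> M"
    proof (rule ccontr)
      assume "y [^] int p \<notin> M"
      then obtain m a where m: "m \<in> M" "c = m \<otimes> (y [^] int p) [^] (a::int)"
        using split[of "y [^] int p"] y by auto
      have "c [^] int n' = m [^] int n' \<otimes> ((y [^] int p) [^] a) [^] int n'"
        using m Mc y by (simp add: int_pow_distrib subsetD)
      also have "((y [^] int p) [^] a) [^] int n' = (y [^] a) [^] n"
        using y by (simp add: int_pow_pow n' algebra_simps flip: int_pow_int)
      also have "m [^] int n' \<otimes> (y [^] a) [^] n \<in> M"
        using m(1) fM y by (intro subgroup.m_closed[OF sgM] subgroup_int_pow_closed[OF sgM]) auto
      finally show False using pn' by (simp add: cM)
    qed
    obtain m a where m: "m \<in> M" "c = m \<otimes> y [^] (a::int)" using split[OF y False] by blast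
    have "\<not> int p dvd a"
    proof
      assume "int p dvd a"
      then obtain a' where "a = int p * a'" by blast
      then have "y [^] a \<in> M" using subgroup_int_pow_closed[OF sgM pM, of a'] y by (simp add: int_pow_pow)
      then have "c \<in> M" using m sgM by (simp add: subgroup.m_closed)
      then show False using cM[of 1] c p by (auto simp: not_prime_unit)
    qed
    then have "coprime (int p) a" using p by (simp add: prime_imp_coprime)
    then obtain u v where uv: "u * int p + v * a = 1" by (metis bezout_int coprime_iff_gcd_eq_1)
    have "y [^] a = inv m \<otimes> c" using m Mc y by (simp add: subsetD flip: m_assoc)
    moreover have "inv m \<otimes> c \<in> K"
      using K m(1) above[OF K] by (intro subgroup.m_closed[OF K(1)] subgroup.m_inv_closed[OF K(1)]) auto
    ultimately have "(y [^] int p) [^] u \<otimes> (y [^] a) [^] v \<in> K"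
      using pM K(2) subgroup_int_pow_closed[OF K(1)] subgroup.m_closed[OF K(1)] by auto
    moreover have "(y [^] int p) [^] u \<otimes> (y [^] a) [^] v = y [^] (u * int p + v * a)"
      using y by (simp add: int_pow_pow int_pow_mult mult.commute)
    ultimately show ?thesis using uv y by simp
  qed (use K in blast)
  have "maximal_subgroup M G"
    unfolding maximal_subgroup_def
  proof (intro conjI allI impI)
    fix K assume K: "subgroup K G" "M \<subseteq> K"
    show "K = M \<or> K = carrier G"
      using gen[of _ K] K subgroup.subset[OF K(1)] by blast
  qed (use sgM xM x in auto)
  then show ?thesis using xM by blast
qed

text \<open>The witness is the radical of \<open>m\<close>, the product of its distinct prime factors.\<close>

lemma radical_exists:
  assumes "m > 0"
  obtains n :: nat where "\<And>p. prime p \<Longrightarrow> p dvd m \<Longrightarrow> p dvd n" "\<And>p. prime p \<Longrightarrow> \<not> p * p dvd n"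
proof
  let ?n = "\<Prod>(prime_factors m)"
  show "p dvd ?n" if "prime p" "p dvd m" for p
    using that assms by (intro dvd_prodI) (auto simp: in_prime_factors_iff)
  show "\<not> p * p dvd ?n" if p: "prime p" for p
  proof
    assume *: "p * p dvd ?n"
    then have "p dvd ?n" by (meson dvd_mult_left)
    then obtain q where q: "q \<in> prime_factors m" "p dvd q"
      using p by (auto simp: prime_dvd_prod_iff)
    then have pm: "p \<in> prime_factors m"
      using p by (metis in_prime_factors_imp_prime primes_dvd_imp_eq)
    then have "?n = p * \<Prod>(prime_factors m - {p})" by (simp add: prod.remove)
    then have "p dvd \<Prod>(prime_factors m - {p})" using * p by (simp add: prime_gt_0_nat)
    then obtain r where r: "r \<in> prime_factors m - {p}" "p dvd r"
      using p by (auto simp: prime_dvd_prod_iff)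
    then show False using p by (metis DiffE in_prime_factors_imp_prime insertI1 primes_dvd_imp_eq)
  qed
qed

section \<open>Maximal subgroups of supersolvable groups\<close>

lemma (in group) maximal_join_carrier:
  assumes M: "maximal_subgroup M G" and N: "N \<lhd> G" "\<not> N \<subseteq> M"
  shows "N <#> M = carrier G"
proof -
  have sg: "subgroup M G" using M by (simp add: maximal_subgroup_def)
  have "subgroup (N <#> M) G" using N(1) sg by (rule mult_norm_subgroup)
  moreover have "M \<subseteq> N <#> M" "N \<subseteq> N <#> M"
    using set_mult_absorbs[OF normal_imp_subgroup[OF N(1)] sg] by auto
  ultimately show ?thesis using M N(2) unfolding maximal_subgroup_def by blast
qed

lemma (in group) conj_int_pow:
  assumes "x \<in> carrier G" "g \<in> carrier G"
  shows "g \<otimes> x [^] (j::int) \<otimes> inv g = (g \<otimes> x \<otimes> inv g) [^] j"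
proof -
  have "(\<lambda>x. g \<otimes> x \<otimes> inv g) \<in> hom G G"
  proof (rule homI)
    fix x y assume "x \<in> carrier G" "y \<in> carrier G"
    moreover from this have "inv g \<otimes> (g \<otimes> (y \<otimes> inv g)) = y \<otimes> inv g"
      using assms by (simp flip: m_assoc)
    ultimately show "g \<otimes> (x \<otimes> y) \<otimes> inv g = g \<otimes> x \<otimes> inv g \<otimes> (g \<otimes> y \<otimes> inv g)"
      using assms by (simp add: m_assoc)
  qed (use assms in simp)
  from hom_int_pow[OF this assms(1) is_group is_group] show ?thesis .
qed

lemma (in group) cyclic_normal_conj:
  assumes "c \<in> carrier G" "generate G {c} \<lhd> G" "g \<in> carrier G"
  obtains i :: int where "g \<otimes> c \<otimes> inv g = c [^] i"
proof -
  have "g \<otimes> c \<otimes> inv g \<in> generate G {c}"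
    using assms by (meson generate.incl insertI1 normal_inv_iff)
  then show ?thesis using that assms(1) by (auto simp: generate_pow)
qed

lemma (in group) cyclic_normal_power:
  assumes c: "c \<in> carrier G" and N: "generate G {c} \<lhd> G"
  shows "generate G {c [^] (k::int)} \<lhd> G"
  unfolding normal_inv_iff
proof (intro conjI ballI)
  show "subgroup (generate G {c [^] k}) G" using c by (intro generate_is_subgroup) simp
  fix g x assume g: "g \<in> carrier G" and x: "x \<in> generate G {c [^] k}"
  obtain j :: int where x: "x = (c [^] k) [^] j" using x c by (auto simp: generate_pow)
  obtain i :: int where i: "g \<otimes> c \<otimes> inv g = c [^] i"
    using cyclic_normal_conj[OF c N g] .
  have "g \<otimes> x \<otimes> inv g = (c [^] k) [^] (i * j)"
    using c g by (simp add: x i conj_int_pow int_pow_pow ac_simps)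
  then show "g \<otimes> x \<otimes> inv g \<in> generate G {c [^] k}" using c by (auto simp: generate_pow)
qed

text \<open>Pass to a power \<open>d\<close> of \<open>c\<close> that lies outside \<open>M\<close> and has prime order \<open>p\<close> modulo \<open>M\<close>. Subgroups of a
cyclic normal subgroup are normal, so \<open>\<langle>d\<rangle>M\<close> is a subgroup and hence all of \<open>G\<close>; the powers of \<open>d\<close>
with exponents below \<open>p\<close> then represent the cosets of \<open>M\<close>.\<close>

lemma (in group) prime_index_of_cyclic_normal:
  assumes fin: "finite (carrier G)" and M: "maximal_subgroup M G"
    and c: "c \<in> carrier G" "c \<notin> M" and N: "generate G {c} \<lhd> G"
  shows "\<exists>p. prime p \<and> card (carrier G) = p * card M"
proof -
  have sg: "subgroup M G" using M by (simp add: maximal_subgroup_def)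
  then have Mc: "M \<subseteq> carrier G" by (rule subgroup.subset)
  obtain p k :: nat where p: "prime p" and dM: "\<And>j::int. (c [^] int k) [^] j \<in> M \<longleftrightarrow> int p dvd j"
    using prime_power_mem_subgroup_iff[OF fin sg c] by metis
  define d where "d = c [^] int k"
  have d: "d \<in> carrier G" using c by (simp add: d_def)
  have dM: "d [^] (j::int) \<in> M \<longleftrightarrow> int p dvd j" for j using dM by (simp add: d_def)
  have "d \<notin> M" using dM[of 1] d p by (auto simp: not_prime_unit)
  then have "\<not> generate G {d} \<subseteq> M" by (meson generate.incl insertI1 subsetD)
  then have G: "generate G {d} <#> M = carrier G"
    using M cyclic_normal_power[OF c(1) N] unfolding d_def by (intro maximal_join_carrier) auto
  let ?f = "\<lambda>(i, m). d [^] int i \<otimes> m"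
  have inj: "inj_on ?f ({..<p} \<times> M)"
  proof (rule inj_onI, clarsimp)
    fix i j m m'
    assume ij: "i < p" "j < p" "m \<in> M" "m' \<in> M" and eq: "d [^] int i \<otimes> m = d [^] int j \<otimes> m'"
    have mc: "m \<in> carrier G" "m' \<in> carrier G" using ij Mc by auto
    have "d [^] int i = d [^] int j \<otimes> (m' \<otimes> inv m)"
      using eq d mc by (metis int_pow_closed inv_closed inv_solve_right m_assoc m_closed)
    then have "d [^] (- int j) \<otimes> d [^] int i = m' \<otimes> inv m"
      using d mc by (simp add: int_pow_neg flip: m_assoc)
    then have "d [^] (int i - int j) \<in> M"
      using ij d sg by (simp add: subgroup.m_closed subgroup.m_inv_closed flip: int_pow_mult)
    then have "int p dvd int i - int j" by (simp add: dM)
    then have "int i mod int p = int j mod int p" by (simp add: mod_eq_dvd_iff)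
    then have "i = j" using ij by simp
    then show "i = j \<and> m = m'" using eq d mc by simp
  qed
  have img: "?f ` ({..<p} \<times> M) = carrier G"
  proof
    show "?f ` ({..<p} \<times> M) \<subseteq> carrier G" using d Mc by auto
    show "carrier G \<subseteq> ?f ` ({..<p} \<times> M)"
    proof
      fix x assume "x \<in> carrier G"
      then have "x \<in> generate G {d} <#> M" by (simp only: G)
      then obtain j m where m: "m \<in> M" "x = d [^] (j::int) \<otimes> m"
        using d by (auto simp: set_mult_def generate_pow)
      let ?r = "nat (j mod int p)"
      have r: "int ?r = j mod int p" "?r < p" using p prime_gt_0_nat[OF p] by (auto simp: nat_less_iff)
      have "d [^] j = d [^] (j mod int p + int p * (j div int p))" by simp
      also have "\<dots> = d [^] int ?r \<otimes> d [^] (int p * (j div int p))"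
        using d by (simp only: int_pow_mult r)
      finally have "x = ?f (?r, d [^] (int p * (j div int p)) \<otimes> m)"
        using m Mc d by (simp add: m_assoc subsetD)
      moreover have "d [^] (int p * (j div int p)) \<otimes> m \<in> M"
        using m sg dM by (intro subgroup.m_closed[OF sg]) auto
      ultimately show "x \<in> ?f ` ({..<p} \<times> M)" using r by blast
    qed
  qed
  have "card (carrier G) = p * card M"
    using card_image[OF inj] by (simp add: img card_cartesian_product)
  then show ?thesis using p by blast
qed

text \<open>Conjugation acts on a cyclic normal subgroup by power maps, and these commute with each other;
commutators therefore act trivially.\<close>

lemma (in group) derived_commutes_with_cyclic_normal:
  assumes c: "c \<in> carrier G" and N: "generate G {c} \<lhd> G" and x: "x \<in> derived G (carrier G)"
  shows "x \<otimes> c = c \<otimes> x"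
proof -
  let ?Z = "{x \<in> carrier G. x \<otimes> c \<otimes> inv x = c}"
  have conj_mult: "(g \<otimes> h) \<otimes> y \<otimes> inv (g \<otimes> h) = g \<otimes> (h \<otimes> y \<otimes> inv h) \<otimes> inv g"
    if "g \<in> carrier G" "h \<in> carrier G" "y \<in> carrier G" for g h y
    using that by (simp add: inv_mult_group m_assoc)
  have conj_inv: "inv g \<otimes> y \<otimes> inv (inv g) = c"
    if "g \<in> carrier G" "y \<in> carrier G" "g \<otimes> c \<otimes> inv g = y" for g y
    using that c by (metis conj_mult inv_closed l_inv l_one inv_one r_one)
  have Z: "subgroup ?Z G"
  proof (rule subgroupI)
    show "?Z \<noteq> {}" using c by (metis (mono_tags, lifting) empty_iff inv_one l_one mem_Collect_eq one_closed r_one)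
  next
    fix g assume "g \<in> ?Z" then show "inv g \<in> ?Z" using c conj_inv by simp
  next
    fix g h assume "g \<in> ?Z" "h \<in> ?Z" then show "g \<otimes> h \<in> ?Z" using c conj_mult by simp
  qed auto
  have z: "inv (h \<otimes> g) \<otimes> (g \<otimes> h) \<in> ?Z" if g: "g \<in> carrier G" and h: "h \<in> carrier G" for g h
  proof -
    obtain i :: int where i: "g \<otimes> c \<otimes> inv g = c [^] i" using cyclic_normal_conj[OF c N g] .
    obtain j :: int where j: "h \<otimes> c \<otimes> inv h = c [^] j" using cyclic_normal_conj[OF c N h] .
    have "g \<otimes> h \<otimes> c \<otimes> inv (g \<otimes> h) = h \<otimes> g \<otimes> c \<otimes> inv (h \<otimes> g)"
      using c g h by (simp add: conj_mult i j conj_int_pow int_pow_pow mult.commute)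
    then have "inv (h \<otimes> g) \<otimes> (g \<otimes> h \<otimes> c \<otimes> inv (g \<otimes> h)) \<otimes> inv (inv (h \<otimes> g)) = c"
      using c g h by (intro conj_inv) auto
    then have "inv (h \<otimes> g) \<otimes> (g \<otimes> h) \<otimes> c \<otimes> inv (inv (h \<otimes> g) \<otimes> (g \<otimes> h)) = c"
      using c g h by (simp only: conj_mult m_closed inv_closed)
    then show ?thesis using g h by simp
  qed
  have "derived_set G (carrier G) \<subseteq> ?Z"
  proof
    fix x assume "x \<in> derived_set G (carrier G)"
    then obtain g h where gh: "g \<in> carrier G" "h \<in> carrier G" "x = g \<otimes> h \<otimes> inv g \<otimes> inv h" by blast
    then have "x = inv (inv h \<otimes> inv g) \<otimes> (inv g \<otimes> inv h)" by (simp add: inv_mult_group m_assoc)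
    then show "x \<in> ?Z" using z[of "inv g" "inv h"] gh by simp
  qed
  then have "derived G (carrier G) \<subseteq> ?Z"
    unfolding derived_def using Z by (rule generate_subgroup_incl)
  then have "x \<in> carrier G" "x \<otimes> c \<otimes> inv x = c" using x by auto
  moreover have "x \<otimes> c \<otimes> inv x \<otimes> x = x \<otimes> c" using calculation(1) c by (simp add: m_assoc)
  ultimately show ?thesis by simp
qed

lemma (in group) commutator_left_factor:
  assumes "u \<in> carrier G" "m \<in> carrier G" "y \<in> carrier G" "u \<otimes> m = m \<otimes> u" "u \<otimes> y = y \<otimes> u"
  shows "u \<otimes> m \<otimes> y \<otimes> inv (u \<otimes> m) \<otimes> inv y = m \<otimes> y \<otimes> inv m \<otimes> inv y"
proof -
  have "u \<otimes> m \<otimes> y = m \<otimes> y \<otimes> u" using assms by (simp add: m_assoc)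
  moreover have "inv (u \<otimes> m) = inv u \<otimes> inv m" unfolding assms(4) using assms by (simp add: inv_mult_group)
  ultimately have "u \<otimes> m \<otimes> y \<otimes> inv (u \<otimes> m) = m \<otimes> y \<otimes> u \<otimes> (inv u \<otimes> inv m)" by simp
  also have "\<dots> = m \<otimes> y \<otimes> (u \<otimes> inv u) \<otimes> inv m" using assms by (simp only: m_assoc m_closed inv_closed)
  finally show ?thesis using assms by simp
qed

text \<open>Both \<open>x\<close> and \<open>y\<close> centralize \<open>c\<close>. Writing them as powers of \<open>c\<close> times elements \<open>m\<close> and \<open>n\<close> of \<open>M\<close>,
also \<open>m\<close> and \<open>n\<close> centralize \<open>c\<close>, so the powers of \<open>c\<close> cancel and the commutator of \<open>x\<close> and \<open>y\<close>
equals that of \<open>m\<close> and \<open>n\<close>.\<close>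

lemma (in group) derived_commutators_in_maximal_cyclic:
  assumes M: "maximal_subgroup M G"
    and c: "c \<in> carrier G" "c \<notin> M" and N: "generate G {c} \<lhd> G"
    and x: "x \<in> derived G (carrier G)" and y: "y \<in> derived G (carrier G)"
  shows "x \<otimes> y \<otimes> inv x \<otimes> inv y \<in> M"
proof -
  have sg: "subgroup M G" using M by (simp add: maximal_subgroup_def)
  then have Mc: "M \<subseteq> carrier G" by (rule subgroup.subset)
  have "\<not> generate G {c} \<subseteq> M" using c by (meson generate.incl insertI1 subsetD)
  then have G: "generate G {c} <#> M = carrier G" using M N by (intro maximal_join_carrier)
  have split: "\<exists>m\<in>M. \<exists>a::int. z = c [^] a \<otimes> m \<and> m \<otimes> c = c \<otimes> m"
    if z: "z \<in> derived G (carrier G)" for z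
  proof -
    have zc: "z \<in> carrier G" using z derived_in_carrier[of "carrier G"] by blast
    then have "z \<in> generate G {c} <#> M" by (simp only: G)
    then obtain a m where m: "m \<in> M" "z = c [^] (a::int) \<otimes> m"
      using c by (auto simp: set_mult_def generate_pow)
    have mc: "m \<in> carrier G" using m Mc by auto
    have ca: "c [^] a \<otimes> c = c \<otimes> c [^] a"
      using c int_pow_mult[of c a 1] int_pow_mult[of c 1 a] by (simp add: add.commute)
    have "c [^] a \<otimes> (m \<otimes> c) = c \<otimes> (c [^] a \<otimes> m)"
      using derived_commutes_with_cyclic_normal[OF c(1) N z] c mc by (simp add: m m_assoc)
    also have "\<dots> = c [^] a \<otimes> (c \<otimes> m)" using ca c mc by (simp flip: m_assoc)
    finally have "m \<otimes> c = c \<otimes> m" using c mc by simp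
    then show ?thesis using m by blast
  qed
  obtain m a where m: "m \<in> M" "x = c [^] (a::int) \<otimes> m" "m \<otimes> c = c \<otimes> m" using split[OF x] by blast
  obtain n b where n: "n \<in> M" "y = c [^] (b::int) \<otimes> n" "n \<otimes> c = c \<otimes> n" using split[OF y] by blast
  have mc: "m \<in> carrier G" and nc: "n \<in> carrier G" using m n Mc by auto
  have xc: "x \<in> carrier G" using m mc c by simp
  have comm_pow: "u \<otimes> c [^] j = c [^] j \<otimes> u" if u: "u \<in> carrier G" "u \<otimes> c = c \<otimes> u" for u and j :: int
  proof -
    have "u \<otimes> c \<otimes> inv u = c" using u c by (simp add: m_assoc)
    then have "u \<otimes> c [^] j \<otimes> inv u = c [^] j" using u c by (simp add: conj_int_pow)
    then show ?thesis using u c by (metis int_pow_closed inv_solve_right m_closed)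
  qed
  have yc: "y \<in> carrier G" using n nc c by simp
  have "x \<otimes> y \<otimes> inv x \<otimes> inv y = m \<otimes> y \<otimes> inv m \<otimes> inv y"
    unfolding m(2) using derived_commutes_with_cyclic_normal[OF c(1) N y] m c mc yc
    by (intro commutator_left_factor) (auto simp: comm_pow)
  also have "\<dots> = inv (y \<otimes> m \<otimes> inv y \<otimes> inv m)" using mc yc by (simp add: inv_mult_group m_assoc)
  also have "y \<otimes> m \<otimes> inv y \<otimes> inv m = n \<otimes> m \<otimes> inv n \<otimes> inv m"
    unfolding n(2) using n m(3) c mc nc by (intro commutator_left_factor) (auto simp: comm_pow)
  also have "inv \<dots> = m \<otimes> n \<otimes> inv m \<otimes> inv n" using mc nc by (simp add: inv_mult_group m_assoc)
  finally have "x \<otimes> y \<otimes> inv x \<otimes> inv y = m \<otimes> n \<otimes> inv m \<otimes> inv n" .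
  then show ?thesis using m(1) n(1) sg by (simp add: subgroup.m_closed subgroup.m_inv_closed)
qed

text \<open>Correspondence of subgroups above the kernel. With the next lemma it transports statements about
a maximal subgroup from a quotient back to the group.\<close>

lemma (in group_hom) mem_if_image_mem:
  assumes "subgroup M G" "kernel G H h \<subseteq> M" "x \<in> carrier G" "h x \<in> h ` M"
  shows "x \<in> M"
proof -
  obtain m where m: "m \<in> M" "h x = h m" using assms(4) by blast
  have mc: "m \<in> carrier G" using m assms(1) subgroup.mem_carrier by fastforce
  then have "x \<otimes> inv m \<in> kernel G H h" using m assms(3) by (simp add: kernel_def)
  then have "x \<otimes> inv m \<otimes> m \<in> M" using assms(1,2) m(1) by (meson subgroup.m_closed subsetD)
  then show ?thesis using mc assms(3) by (simp add: G.m_assoc)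
qed

lemma (in group_hom) maximal_subgroup_image:
  assumes surj: "h ` carrier G = carrier H" and ker: "kernel G H h \<subseteq> M"
    and M: "maximal_subgroup M G"
  shows "maximal_subgroup (h ` M) H"
proof -
  have sg: "subgroup M G" and ne: "M \<noteq> carrier G"
    and max: "\<And>K. subgroup K G \<Longrightarrow> M \<subseteq> K \<Longrightarrow> K = M \<or> K = carrier G"
    using M by (auto simp: maximal_subgroup_def)
  have Mc: "M \<subseteq> carrier G" using sg by (rule subgroup.subset)
  show ?thesis
    unfolding maximal_subgroup_def
  proof (intro conjI allI impI)
    show "subgroup (h ` M) H" using sg by (rule subgroup_img_is_subgroup)
    show "h ` M \<noteq> carrier H"
    proof
      assume "h ` M = carrier H"
      then have "carrier G \<subseteq> M" using mem_if_image_mem[OF sg ker] surj by blast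
      then show False using ne Mc by blast
    qed
  next
    fix K assume K: "subgroup K H" "h ` M \<subseteq> K"
    let ?K = "{x \<in> carrier G. h x \<in> K}"
    have img: "h ` ?K = K"
      using subgroup.subset[OF K(1)] unfolding surj[symmetric] by blast
    have "?K = M \<or> ?K = carrier G"
      using K Mc by (intro max subgroup_vimage) auto
    then show "K = h ` M \<or> K = carrier H" using img surj by metis
  qed
qed

lemma (in normal) coset_group_hom: "group_hom G (G Mod H) (\<lambda>x. H #> x)"
  by (intro group_hom.intro group_hom_axioms.intro is_group factorgroup_is_group r_coset_hom_Mod)

lemma (in normal) coset_kernel: "kernel G (G Mod H) (\<lambda>x. H #> x) = H"
  unfolding kernel_def using coset_join1[OF _ _ is_subgroup] coset_join2[OF _ is_subgroup] subset by auto

text \<open>\<open>N\<close> is the last term of the series inside \<open>M\<close>, and \<open>x\<close> generates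
the next term modulo \<open>N\<close>. That term is normal in \<open>G\<close>, so the cyclic group generated by the coset of
\<open>x\<close> is normal in the quotient.\<close>

lemma (in group) supersolvable_maximal_step:
  assumes ss: "supersolvable G" and M: "maximal_subgroup M G"
  shows "\<exists>N x. N \<lhd> G \<and> N \<subseteq> M \<and> x \<in> carrier G \<and> x \<notin> M \<and>
           generate (G Mod N) {N #> x} \<lhd> (G Mod N)"
proof -
  have sg: "subgroup M G" and ne: "M \<noteq> carrier G" using M by (auto simp: maximal_subgroup_def)
  obtain N n where N0: "N 0 = {\<one>}" and Nn: "N n = carrier G"
    and norm: "\<And>i. i \<le> n \<Longrightarrow> N i \<lhd> G"
    and step: "\<And>i. i < n \<Longrightarrow> N i \<subset> N (Suc i) \<and> cyclic_group (G\<lparr>carrier := N (Suc i)\<rparr> Mod N i)"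
    using ss unfolding supersolvable_def by auto
  have "\<not> N n \<subseteq> M" using ne Nn subgroup.subset[OF sg] by blast
  moreover have "N 0 \<subseteq> M" using N0 sg by (simp add: subgroup.one_closed)
  ultimately obtain i where i: "i < n" "N i \<subseteq> M" "\<not> N (Suc i) \<subseteq> M"
    using dec_induct[of 0 n "\<lambda>i. N i \<subseteq> M"] by auto
  let ?X = "N (Suc i)" and ?N = "N i"
  let ?GX = "G\<lparr>carrier := ?X\<rparr>"
  have normX: "?X \<lhd> G" and normN: "?N \<lhd> G" and NX: "?N \<subseteq> ?X" using i norm step by auto
  interpret N: normal ?N G by (rule normN)
  interpret h: group_hom G "G Mod ?N" "\<lambda>x. ?N #> x" by (rule N.coset_group_hom)
  have sgX: "subgroup ?X G" using normX by (rule normal_imp_subgroup)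
  then have Xc: "?X \<subseteq> carrier G" by (rule subgroup.subset)
  interpret X: normal ?N ?GX by (rule normal_restrict_supergroup[OF sgX normN NX])
  obtain C where C: "C \<in> carrier (?GX Mod ?N)"
    "carrier (?GX Mod ?N) = range (\<lambda>k::int. C [^]\<^bsub>?GX Mod ?N\<^esub> k)"
    using step[OF i(1)] group.cyclic_group[OF X.factorgroup_is_group] by blast
  obtain x where x: "x \<in> ?X" "C = ?N #> x"
    using C(1) by (auto simp: carrier_FactGroup)
  have xc: "x \<in> carrier G" using x Xc by blast
  \<comment> \<open>The cyclic factor is a quotient of the subgroup \<open>X\<close>; its powers agree with those in \<open>G / N\<close>.\<close>
  have pow: "C [^]\<^bsub>?GX Mod ?N\<^esub> k = (?N #> x) [^]\<^bsub>G Mod ?N\<^esub> k" for k :: int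
    using X.FactGroup_int_pow[of x k] N.FactGroup_int_pow[OF xc, of k] x
      int_pow_consistent[OF sgX x(1), of k] by simp
  have img: "(\<lambda>y. ?N #> y) ` ?X = generate (G Mod ?N) {?N #> x}"
  proof -
    have "(\<lambda>y. ?N #> y) ` ?X = carrier (?GX Mod ?N)" by (simp add: carrier_FactGroup)
    also have "\<dots> = range (\<lambda>k::int. (?N #> x) [^]\<^bsub>G Mod ?N\<^esub> k)" by (simp only: C(2) pow)
    also have "\<dots> = generate (G Mod ?N) {?N #> x}"
      using xc by (subst h.H.generate_pow) auto
    finally show ?thesis .
  qed
  have "generate (G Mod ?N) {?N #> x} \<lhd> (G Mod ?N)"
    unfolding img[symmetric]
    by (rule normal.surj_hom_normal_subgroup[OF normX h.group_hom_axioms])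
      (simp add: carrier_FactGroup)
  moreover have "x \<notin> M"
  proof
    assume "x \<in> M"
    then have "generate (G Mod ?N) {?N #> x} \<subseteq> (\<lambda>y. ?N #> y) ` M"
      using h.subgroup_img_is_subgroup[OF sg] by (intro h.H.generate_subgroup_incl) auto
    then have "?X \<subseteq> M"
      using h.mem_if_image_mem[OF sg] N.coset_kernel i(2) Xc img by blast
    then show False using i by blast
  qed
  ultimately show ?thesis using normN i(2) xc by blast
qed

text \<open>Both statements hold in the quotient by the subgroup \<open>N \<le> M\<close> of the previous lemma, where the
image of \<open>M\<close> misses a generator of a cyclic normal subgroup. The second one says that the second
derived subgroup lies in the Frattini subgroup.\<close>

lemma (in group) supersolvable_maximal_subgroup:
  assumes fin: "finite (carrier G)" and ss: "supersolvable G" and M: "maximal_subgroup M G"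
  shows "\<exists>p. prime p \<and> card (carrier G) = p * card M"
    and "\<And>x y. x \<in> derived G (carrier G) \<Longrightarrow> y \<in> derived G (carrier G) \<Longrightarrow>
           x \<otimes> y \<otimes> inv x \<otimes> inv y \<in> M"
proof -
  have sg: "subgroup M G" using M by (auto simp: maximal_subgroup_def)
  obtain N c where N: "N \<lhd> G" "N \<subseteq> M" and c: "c \<in> carrier G" "c \<notin> M"
    and cyc: "generate (G Mod N) {N #> c} \<lhd> (G Mod N)"
    using supersolvable_maximal_step[OF ss M] by blast
  interpret N: normal N G by (rule N(1))
  interpret h: group_hom G "G Mod N" "\<lambda>x. N #> x" by (rule N.coset_group_hom)
  let ?h = "\<lambda>x. N #> x"
  have ker: "kernel G (G Mod N) ?h = N" by (rule N.coset_kernel)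
  have surj: "?h ` carrier G = carrier (G Mod N)" by (simp add: carrier_FactGroup)
  have M': "maximal_subgroup (?h ` M) (G Mod N)"
    using N(2) ker by (intro h.maximal_subgroup_image[OF surj _ M]) simp
  have mem: "x \<in> M" if "x \<in> carrier G" "?h x \<in> ?h ` M" for x
    using that N(2) ker by (intro h.mem_if_image_mem[OF sg]) simp_all
  have c': "?h c \<in> carrier (G Mod N)" "?h c \<notin> ?h ` M" using c mem by auto
  obtain p where p: "prime p" "card (carrier (G Mod N)) = p * card (?h ` M)"
    using h.H.prime_index_of_cyclic_normal[OF _ M' c' cyc] fin surj by (metis finite_imageI)
  have "card (carrier G) = p * card M"
    using h.card_subgroup_image_kernel[OF fin subgroup_self] h.card_subgroup_image_kernel[OF fin sg]
      p(2) N(2) N.subset by (simp add: ker surj inf.absorb2)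
  then show "\<exists>p. prime p \<and> card (carrier G) = p * card M" using p(1) by blast
  fix x y assume x: "x \<in> derived G (carrier G)" and y: "y \<in> derived G (carrier G)"
  have xc: "x \<in> carrier G" and yc: "y \<in> carrier G" using x y derived_in_carrier[of "carrier G"] by auto
  have D: "?h ` derived G (carrier G) = derived (G Mod N) (carrier (G Mod N))"
    using h.derived_img[of "carrier G"] by (simp add: surj)
  then have "?h x \<in> derived (G Mod N) (carrier (G Mod N))" "?h y \<in> derived (G Mod N) (carrier (G Mod N))"
    using x y by blast+
  from h.H.derived_commutators_in_maximal_cyclic[OF M' c' cyc this]
  have "?h (x \<otimes> y \<otimes> inv x \<otimes> inv y) \<in> ?h ` M" using xc yc by simp
  then show "x \<otimes> y \<otimes> inv x \<otimes> inv y \<in> M" using xc yc by (intro mem) auto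
qed

section \<open>Cutting a normal subgroup down to its Frattini part\<close>

lemma (in group) subgroup_le_maximal:
  assumes fin: "finite (carrier G)" and K: "subgroup K G" "K \<noteq> carrier G"
  obtains M where "maximal_subgroup M G" "K \<subseteq> M"
proof -
  let ?\<L> = "{L. subgroup L G \<and> L \<noteq> carrier G}"
  have "finite ?\<L>"
    using fin by (rule_tac finite_subset[of _ "Pow (carrier G)"]) (auto dest: subgroup.subset)
  then obtain M where "M \<in> ?\<L>" "K \<subseteq> M" "\<And>L. L \<in> ?\<L> \<Longrightarrow> M \<subseteq> L \<Longrightarrow> L = M"
    using finite_has_maximal2[of ?\<L> K] K by auto
  then show ?thesis using that[of M] unfolding maximal_subgroup_def by blast
qed

lemma mem_frattini_iff:
  "x \<in> frattini G \<longleftrightarrow> x \<in> carrier G \<and> (\<forall>M. maximal_subgroup M G \<longrightarrow> x \<in> M)"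
  by (auto simp: frattini_def subgroup_Inter_def)

lemma (in group) frattini_subgroup: "subgroup (frattini G) G"
proof (rule subgroupI)
  have "\<one> \<in> frattini G" by (simp add: mem_frattini_iff maximal_subgroup_def subgroup.one_closed)
  then show "frattini G \<noteq> {}" by blast
qed (auto simp: mem_frattini_iff maximal_subgroup_def intro: subgroup.m_closed subgroup.m_inv_closed)

text \<open>The map \<open>G \<rightarrow> G/N\<close> is already surjective on \<open>M\<close>.\<close>

lemma (in group) card_normal_product:
  assumes fin: "finite (carrier G)" and N: "N \<lhd> G" and M: "subgroup M G" and G: "N <#> M = carrier G"
  shows "card (carrier G) * card (N \<inter> M) = card M * card N"
proof -
  interpret N: normal N G by (rule N)
  interpret h: group_hom G "G Mod N" "\<lambda>x. N #> x" by (rule N.coset_group_hom)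
  have "(\<lambda>x. N #> x) ` carrier G \<subseteq> (\<lambda>x. N #> x) ` M"
  proof (rule image_subsetI)
    fix x assume "x \<in> carrier G"
    then obtain a m where am: "a \<in> N" "m \<in> M" "x = a \<otimes> m" unfolding G[symmetric] set_mult_def by blast
    then have "N #> x = N #> m"
      using N.subset subgroup.subset[OF M] by (simp add: N.rcos_const subsetD flip: coset_mult_assoc)
    then show "N #> x \<in> (\<lambda>x. N #> x) ` M" using am by blast
  qed
  then have "(\<lambda>x. N #> x) ` carrier G = (\<lambda>x. N #> x) ` M" using subgroup.subset[OF M] by blast
  moreover have "carrier G \<inter> N = N" "N \<inter> M = M \<inter> N" using N.subset by auto
  ultimately show ?thesis
    using h.card_subgroup_image_kernel[OF fin subgroup_self] h.card_subgroup_image_kernel[OF fin M]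
    by (simp add: N.coset_kernel)
qed

lemma (in group) prime_index_no_intermediate:
  assumes fin: "finite (carrier G)" and A: "subgroup A G" and B: "subgroup B G" and R: "subgroup R G"
    and AR: "A \<subset> R" and RB: "R \<subseteq> B" and p: "prime p" "card B = p * card A"
  shows "R = B"
proof -
  obtain q where q: "card R = card A * q" using card_subgroup_dvd[OF A R] AR by blast
  have "card R dvd card B" using card_subgroup_dvd[OF R B RB] .
  then have "card A * q dvd card A * p" using p q by (simp add: mult.commute)
  then have "q dvd p" using card_subgroup_pos[OF fin A] by simp
  moreover have "q \<noteq> 1" using q AR finite_subgroup[OF fin R] psubset_card_mono[of R A] by auto
  ultimately have "q = p" using p(1) by (auto simp: prime_nat_iff)
  then have "card R = card B" using q p by simp
  then show ?thesis using RB finite_subgroup[OF fin B] by (simp add: card_subset_eq)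
qed

text \<open>\<open>M\<close> normalizes \<open>P \<inter> M\<close>, and so does \<open>P\<close>: conjugating \<open>y \<in> P \<inter> M\<close> by \<open>e \<in> P\<close> multiplies it by the
commutator of \<open>e\<close> and \<open>y\<close>, which is in \<open>M\<close>. Together they generate \<open>G\<close>.\<close>

lemma (in group) normal_Int_supplement:
  assumes P: "P \<lhd> G" and M: "subgroup M G" and PM: "P <#> M = carrier G"
    and comm: "\<And>x y. x \<in> P \<Longrightarrow> y \<in> P \<Longrightarrow> x \<otimes> y \<otimes> inv x \<otimes> inv y \<in> M"
  shows "(P \<inter> M) \<lhd> G"
  unfolding normal_inv_iff
proof (intro conjI ballI)
  have sP: "subgroup P G" using P by (rule normal_imp_subgroup)
  then show "subgroup (P \<inter> M) G" using M by (rule subgroups_Inter_pair)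
  fix g x assume g: "g \<in> carrier G" and x: "x \<in> P \<inter> M"
  then obtain e m where em: "e \<in> P" "m \<in> M" "g = e \<otimes> m" unfolding PM[symmetric] set_mult_def by blast
  have mc: "m \<in> carrier G" "e \<in> carrier G" "x \<in> carrier G"
    using em x subgroup.mem_carrier[OF M] subgroup.mem_carrier[OF sP] by auto
  let ?y = "m \<otimes> x \<otimes> inv m"
  have yM: "?y \<in> M" using em x M by (simp add: subgroup.m_closed subgroup.m_inv_closed)
  have yP: "?y \<in> P" using x mc P by (meson IntD1 normal_inv_iff)
  have yc: "?y \<in> carrier G" using mc by simp
  have "e \<otimes> ?y \<otimes> inv e \<otimes> inv ?y \<otimes> ?y \<in> M"
    using comm[OF em(1) yP] yM by (rule subgroup.m_closed[OF M])
  moreover have "e \<otimes> ?y \<otimes> inv e \<otimes> inv ?y \<otimes> ?y = e \<otimes> ?y \<otimes> inv e"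
    using mc(2) yc by (metis inv_closed l_inv m_assoc m_closed r_one)
  moreover have "e \<otimes> ?y \<otimes> inv e = g \<otimes> x \<otimes> inv g"
    using mc em(3) by (simp add: inv_mult_group m_assoc)
  moreover have "g \<otimes> x \<otimes> inv g \<in> P" using x g P by (meson IntD1 normal_inv_iff)
  ultimately show "g \<otimes> x \<otimes> inv g \<in> P \<inter> M" by simp
qed

text \<open>A form of Dedekind's law: \<open>c = e m\<close> with \<open>e \<in> D \<inter> C\<close> and \<open>m \<in> M\<close> forces \<open>m \<in> C \<inter> M\<close>, and \<open>e\<close> can be
moved past \<open>m\<close> into \<open>D\<close>.\<close>

lemma (in group) supplement_Int:
  assumes C: "subgroup C G" and D: "D \<lhd> G" and M: "subgroup M G"
    and CD: "C <#> D = carrier G" and PM: "(D \<inter> C) <#> M = carrier G"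
  shows "(C \<inter> M) <#> D = carrier G"
proof
  interpret D: normal D G by (rule D)
  have Cc: "C \<subseteq> carrier G" using C by (rule subgroup.subset)
  then show "(C \<inter> M) <#> D \<subseteq> carrier G" using D.subset by (intro setmult_subset_G) auto
  show "carrier G \<subseteq> (C \<inter> M) <#> D"
  proof
    fix g assume "g \<in> carrier G"
    then obtain c b where cb: "c \<in> C" "b \<in> D" "g = c \<otimes> b"
      unfolding CD[symmetric] set_mult_def by blast
    then have "c \<in> (D \<inter> C) <#> M" using Cc unfolding PM by blast
    then obtain e m where em: "e \<in> D" "e \<in> C" "m \<in> M" "c = e \<otimes> m" unfolding set_mult_def by blast
    have mc: "m \<in> carrier G" "e \<in> carrier G" "b \<in> carrier G"
      using em cb Cc subgroup.mem_carrier[OF M] by auto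
    have "inv e \<otimes> c \<in> C" using em(2) cb(1) C by (simp add: subgroup.m_closed subgroup.m_inv_closed)
    then have "m \<in> C \<inter> M" using em(3,4) mc by (simp flip: m_assoc)
    moreover have "inv m \<otimes> e \<otimes> m \<otimes> b \<in> D"
      using D.inv_op_closed1[OF mc(1) em(1)] cb(2) by (rule D.m_closed)
    moreover have "g = m \<otimes> (inv m \<otimes> e \<otimes> m \<otimes> b)"
      using cb(3) em(4) mc by (simp flip: m_assoc)
    ultimately show "g \<in> (C \<inter> M) <#> D" unfolding set_mult_def by blast
  qed
qed

text \<open>Let \<open>\<M>\<close> be a family of maximal subgroups of least size whose intersection with \<open>D\<close> is
\<open>D \<inter> \<Phi>\<close>. Minimality gives for each \<open>M \<in> \<M>\<close> an element \<open>d M\<close> of \<open>D\<close> that avoids \<open>M\<close> and lies in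
all other members. Intersecting \<open>D\<close> with the members one at a time gives subgroups that are
normal in \<open>G\<close>, each of prime index in the one before, and \<open>d M\<close> generates the factor at which \<open>M\<close>
is intersected. Since the primes are counted exactly, \<open>|\<M>| = \<Omega>(|D|) - \<Omega>(|D \<inter> \<Phi>|)\<close>. The set
\<open>\<D>\<close> consists of the \<open>d M\<close>, and \<open>C\<close> is the intersection of \<open>\<M>\<close>, a supplement of \<open>D\<close> that every
\<open>M\<close> contains.\<close>

lemma (in group) independent_maximal_family:
  assumes fin: "finite (carrier G)" and D: "D \<lhd> G"
    and comm: "\<And>M x y. maximal_subgroup M G \<Longrightarrow> x \<in> D \<Longrightarrow> y \<in> D \<Longrightarrow> x \<otimes> y \<otimes> inv x \<otimes> inv y \<in> M"
    and idx: "\<And>M. maximal_subgroup M G \<Longrightarrow> \<exists>p. prime p \<and> card (carrier G) = p * card M"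
  obtains \<D> C where "\<D> \<subseteq> D" "subgroup C G" "C <#> D = carrier G"
    "card \<D> + Omega (card (D \<inter> frattini G)) = Omega (card D)"
    "D \<subseteq> generate G (\<D> \<union> (D \<inter> frattini G))"
    "\<forall>d\<in>\<D>. \<exists>M. maximal_subgroup M G \<and> C \<union> (\<D> - {d}) \<subseteq> M \<and> d \<notin> M"
proof -
  interpret D: normal D G by (rule D)
  let ?Max = "{M. maximal_subgroup M G}"
  have sgM: "subgroup M G" if "maximal_subgroup M G" for M using that by (simp add: maximal_subgroup_def)
  have finMax: "finite ?Max"
    using fin by (rule_tac finite_subset[of _ "Pow (carrier G)"]) (auto dest!: sgM subgroup.subset)
  define P where "P \<M> \<longleftrightarrow> \<M> \<subseteq> ?Max \<and> D \<inter> \<Inter>\<M> \<subseteq> frattini G" for \<M>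
  have "P ?Max" using D.subset by (auto simp: P_def mem_frattini_iff)
  then obtain \<M> where "P \<M>" and lP: "\<And>\<N>. P \<N> \<Longrightarrow> card \<M> \<le> card \<N>"
    using ex_has_least_nat[of P ?Max card] by metis
  then have \<M>: "\<M> \<subseteq> ?Max" "D \<inter> \<Inter>\<M> \<subseteq> frattini G" by (simp_all add: P_def)
  have fin\<M>: "finite \<M>" using \<M>(1) finMax by (rule finite_subset)
  have E: "D \<inter> \<Inter>\<M> = D \<inter> frattini G" using \<M> by (auto simp: mem_frattini_iff)
  have "\<exists>d. d \<in> D \<inter> \<Inter>(\<M> - {M}) \<and> d \<notin> M" if M: "M \<in> \<M>" for M
  proof (rule ccontr)
    assume "\<not> ?thesis"
    then have "D \<inter> \<Inter>(\<M> - {M}) \<subseteq> D \<inter> \<Inter>\<M>" by blast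
    then have "P (\<M> - {M})" using \<M> by (auto simp: P_def)
    then show False using lP[of "\<M> - {M}"] M fin\<M> by (meson card_Diff1_less not_le)
  qed
  then obtain d where d: "\<And>M. M \<in> \<M> \<Longrightarrow> d M \<in> D \<and> d M \<notin> M"
    and d': "\<And>M N. M \<in> \<M> \<Longrightarrow> N \<in> \<M> \<Longrightarrow> M \<noteq> N \<Longrightarrow> d M \<in> N" by (metis Diff_iff Int_iff Inter_iff singletonD)
  have dc: "d ` \<F> \<subseteq> carrier G" if "\<F> \<subseteq> \<M>" for \<F> using that d D.subset by blast
  have sC: "subgroup (carrier G \<inter> \<Inter>\<F>) G" if "\<F> \<subseteq> \<M>" for \<F>
  proof -
    have sg: "subgroup N G" if "N \<in> \<F>" for N using sgM that \<open>\<F> \<subseteq> \<M>\<close> \<M>(1) by blast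
    show ?thesis
    proof (rule subgroupI)
      have "\<one> \<in> carrier G \<inter> \<Inter>\<F>" using sg subgroup.one_closed by auto
      then show "carrier G \<inter> \<Inter>\<F> \<noteq> {}" by blast
    qed (use sg in \<open>auto intro: subgroup.m_closed subgroup.m_inv_closed\<close>)
  qed
  have main: "(D \<inter> \<Inter>\<F>) \<lhd> G \<and> card \<F> + Omega (card (D \<inter> \<Inter>\<F>)) = Omega (card D) \<and>
      (carrier G \<inter> \<Inter>\<F>) <#> D = carrier G \<and> D \<subseteq> generate G (d ` \<F> \<union> (D \<inter> \<Inter>\<F>))"
    if "finite \<F>" "\<F> \<subseteq> \<M>" for \<F>
    using that
  proof (induction \<F>)
    case empty
    have "D \<subseteq> generate G D" by (auto intro: generate.incl)
    moreover have "carrier G <#> D = carrier G"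
      using set_mult_absorbs(1)[OF subgroup_self D.is_subgroup] setmult_subset_G[of "carrier G" D] D.subset
      by blast
    ultimately show ?case using D by simp
  next
    case (insert M \<F>)
    let ?P = "D \<inter> \<Inter>\<F>"
    have IH: "?P \<lhd> G" "card \<F> + Omega (card ?P) = Omega (card D)"
      "(carrier G \<inter> \<Inter>\<F>) <#> D = carrier G" "D \<subseteq> generate G (d ` \<F> \<union> ?P)"
      using insert by auto
    have MM: "M \<in> \<M>" and max: "maximal_subgroup M G" and MF: "M \<notin> \<F>" "\<F> \<subseteq> \<M>"
      using insert \<M> by auto
    have sM: "subgroup M G" using max by (rule sgM)
    have sP: "subgroup ?P G" using IH(1) by (rule normal_imp_subgroup)
    have dP: "d M \<in> ?P" "d M \<notin> M" using d[OF MM] d'[OF MM] MF by auto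
    \<comment> \<open>\<open>d M\<close> shows that the normal subgroup \<open>P\<close> is not contained in \<open>M\<close>, so \<open>P M = G\<close> and
      the index of \<open>P \<inter> M\<close> in \<open>P\<close> is the prime index of \<open>M\<close> in \<open>G\<close>.\<close>
    have PM: "?P <#> M = carrier G" using dP by (intro maximal_join_carrier[OF max IH(1)]) blast
    obtain p where p: "prime p" "card (carrier G) = p * card M" using idx[OF max] by blast
    have sQ: "subgroup (?P \<inter> M) G" using sP sM by (rule subgroups_Inter_pair)
    have idxP: "card ?P = p * card (?P \<inter> M)"
      using card_normal_product[OF fin IH(1) sM PM] p card_subgroup_pos[OF fin sM] by simp
    have ins: "D \<inter> \<Inter>(insert M \<F>) = ?P \<inter> M" by blast
    have "(?P \<inter> M) \<lhd> G"
      using comm[OF max] by (intro normal_Int_supplement[OF IH(1) sM PM]) auto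
    moreover have "card (insert M \<F>) + Omega (card (?P \<inter> M)) = Omega (card D)"
      using IH(2) idxP insert.hyps p(1) Omega_prime[OF p(1)] card_subgroup_pos[OF fin sQ] prime_gt_0_nat[OF p(1)]
      by (simp add: Omega_mult)
    moreover have "(carrier G \<inter> \<Inter>(insert M \<F>)) <#> D = carrier G"
    proof -
      have "carrier G \<inter> \<Inter>(insert M \<F>) = (carrier G \<inter> \<Inter>\<F>) \<inter> M" by blast
      moreover have "D \<inter> (carrier G \<inter> \<Inter>\<F>) = ?P" using D.subset by blast
      ultimately show ?thesis
        using supplement_Int[OF sC[OF MF(2)] D sM IH(3)] PM by simp
    qed
    moreover have "D \<subseteq> generate G (d ` insert M \<F> \<union> (?P \<inter> M))" (is "_ \<subseteq> ?R")
    proof -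
      have sub: "d ` insert M \<F> \<union> (?P \<inter> M) \<subseteq> carrier G"
        using dc[of "insert M \<F>"] insert.prems D.subset by blast
      then have sR: "subgroup ?R G" by (rule generate_is_subgroup)
      \<comment> \<open>There is nothing strictly between \<open>P \<inter> M\<close> and \<open>P\<close>, and \<open>d M\<close> leads out of \<open>P \<inter> M\<close>.\<close>
      have "?R \<inter> ?P = ?P"
      proof (rule prime_index_no_intermediate[OF fin sQ sP _ _ _ p(1) idxP])
        show "subgroup (?R \<inter> ?P) G" using sR sP by (rule subgroups_Inter_pair)
        have "?P \<inter> M \<subseteq> ?R \<inter> ?P" "d M \<in> ?R" by (auto intro: generate.incl)
        then show "?P \<inter> M \<subset> ?R \<inter> ?P" using dP by blast
      qed (rule Int_lower2)
      then have "d ` \<F> \<union> ?P \<subseteq> ?R" by (auto intro: generate.incl)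
      then have "generate G (d ` \<F> \<union> ?P) \<subseteq> ?R" using sR by (rule generate_subgroup_incl)
      then show ?thesis using IH(4) by blast
    qed
    ultimately show ?case unfolding ins by blast
  qed
  note main = main[OF fin\<M> subset_refl]
  let ?C = "carrier G \<inter> \<Inter>\<M>"
  have inj: "inj_on d \<M>" using d d' by (metis inj_onI)
  show ?thesis
  proof (rule that[of "d ` \<M>" ?C])
    show "d ` \<M> \<subseteq> D" using d by blast
    show "subgroup ?C G" by (rule sC) simp
    show "?C <#> D = carrier G" using main by simp
    show "card (d ` \<M>) + Omega (card (D \<inter> frattini G)) = Omega (card D)"
      using main by (simp add: card_image[OF inj] E)
    show "D \<subseteq> generate G (d ` \<M> \<union> (D \<inter> frattini G))" using main by (simp add: E)
    show "\<forall>x\<in>d ` \<M>. \<exists>M. maximal_subgroup M G \<and> ?C \<union> (d ` \<M> - {x}) \<subseteq> M \<and> x \<notin> M"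
    proof
      fix x assume "x \<in> d ` \<M>"
      then obtain M where "M \<in> \<M>" "x = d M" by blast
      then show "\<exists>M. maximal_subgroup M G \<and> ?C \<union> (d ` \<M> - {x}) \<subseteq> M \<and> x \<notin> M"
        using \<M>(1) d d' by (intro exI[of _ M]) blast
    qed
  qed
qed

section \<open>The largest independent sets generate\<close>

text \<open>The equality \<open>m = i\<close> for finite abelian groups. Independent sets have at most
\<open>\<Omega>(|G|) - \<Omega>(|G\<^sup>n|)\<close> elements, where \<open>n\<close> is the radical of the order. The family lemma with \<open>D = G\<close>
attains \<open>\<Omega>(|G|) - \<Omega>(|\<Phi>|)\<close>, which is at least as large because \<open>\<Phi>\<close> consists of \<open>n\<close>-th powers.\<close>

lemma (in comm_group) independent_generating_set_ge:
  assumes fin: "finite (carrier G)" and U: "U \<subseteq> carrier G" "indep_mod G {} U"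
  obtains V where "V \<subseteq> carrier G" "indep_mod G {} V" "generate G V = carrier G" "card U \<le> card V"
proof -
  have "order G > 0" using fin by (simp add: order_gt_0_iff_finite)
  then obtain n where n: "\<And>p. prime p \<Longrightarrow> p dvd order G \<Longrightarrow> p dvd n" "\<And>p. prime p \<Longrightarrow> \<not> p * p dvd n"
    using radical_exists by blast
  let ?A = "(\<lambda>x. x [^] n) ` carrier G"
  interpret f: group_hom G G "\<lambda>x. x [^] n" by (rule pow_group_hom)
  have upper: "card U + Omega (card ?A) \<le> Omega (card (carrier G))"
    using indep_card_bound[OF fin U n(1)] by blast
  have "frattini G \<subseteq> ?A"
  proof
    fix x assume x: "x \<in> frattini G"
    show "x \<in> ?A"
    proof (rule ccontr)
      assume "x \<notin> ?A"
      then have "\<exists>M. maximal_subgroup M G \<and> x \<notin> M"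
        using x by (intro maximal_subgroup_avoiding[OF fin _ _ n(2)]) (auto simp: mem_frattini_iff)
      then show False using x by (auto simp: mem_frattini_iff)
    qed
  qed
  then have PhiA: "Omega (card (frattini G)) \<le> Omega (card ?A)"
    using fin frattini_subgroup f.img_is_subgroup by (intro Omega_subgroup_mono)
  have idx: "\<exists>p. prime p \<and> card (carrier G) = p * card M" if M: "maximal_subgroup M G" for M
  proof -
    have "subgroup M G" "M \<noteq> carrier G" using M by (auto simp: maximal_subgroup_def)
    then obtain c where c: "c \<in> carrier G" "c \<notin> M" using subgroup.subset by blast
    then have "generate G {c} \<lhd> G" by (intro subgroup_imp_normal generate_is_subgroup) simp
    then show ?thesis using prime_index_of_cyclic_normal[OF fin M c] by blast
  qed
  have comm: "x \<otimes> y \<otimes> inv x \<otimes> inv y \<in> M"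
    if "maximal_subgroup M G" "x \<in> carrier G" "y \<in> carrier G" for M x y
  proof -
    have "x \<otimes> y \<otimes> inv x \<otimes> inv y = y \<otimes> x \<otimes> inv x \<otimes> inv y" using that by (simp add: m_comm)
    also have "\<dots> = \<one>" using that by (simp add: m_assoc)
    finally show ?thesis using that(1) by (simp add: maximal_subgroup_def subgroup.one_closed)
  qed
  obtain \<D> C where \<D>: "\<D> \<subseteq> carrier G"
    and "subgroup C G" "C <#> carrier G = carrier G"
    and card: "card \<D> + Omega (card (carrier G \<inter> frattini G)) = Omega (card (carrier G))"
    and gen: "carrier G \<subseteq> generate G (\<D> \<union> (carrier G \<inter> frattini G))"
    and max: "\<forall>d\<in>\<D>. \<exists>M. maximal_subgroup M G \<and> C \<union> (\<D> - {d}) \<subseteq> M \<and> d \<notin> M"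
    using independent_maximal_family[OF fin normal_self comm idx] .
  have "carrier G \<inter> frattini G = frattini G" by (auto simp: mem_frattini_iff)
  then have "card U \<le> card \<D>" using upper PhiA card by simp
  moreover have "indep_mod G {} \<D>"
    unfolding indep_mod_def
  proof
    fix d assume "d \<in> \<D>"
    then obtain M where M: "maximal_subgroup M G" "\<D> - {d} \<subseteq> M" "d \<notin> M" using max by blast
    then have "generate G (\<D> - {d}) \<subseteq> M" by (intro generate_subgroup_incl) (auto simp: maximal_subgroup_def)
    then show "d \<notin> generate G ({} \<union> (\<D> - {d}))" using M by auto
  qed
  moreover have "generate G \<D> = carrier G"
  proof (rule ccontr)
    assume "generate G \<D> \<noteq> carrier G"
    then obtain M where M: "maximal_subgroup M G" "generate G \<D> \<subseteq> M"
      using subgroup_le_maximal[OF fin generate_is_subgroup[OF \<D>]] by blast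
    have sg: "subgroup M G" and ne: "M \<noteq> carrier G" using M by (auto simp: maximal_subgroup_def)
    \<comment> \<open>Frattini elements are non-generators.\<close>
    have "\<D> \<union> (carrier G \<inter> frattini G) \<subseteq> M"
      using M generate.incl[of _ \<D> G] by (auto simp: mem_frattini_iff)
    then have "carrier G \<subseteq> M" using gen sg generate_subgroup_incl by blast
    then show False using ne subgroup.subset[OF sg] by blast
  qed
  ultimately show ?thesis using that \<D> by blast
qed

text \<open>The upper bound \<open>|S| \<le> |U| + \<Omega>(|D|) - \<Omega>(|E|)\<close>, with \<open>U\<close> independent in the abelian quotient
\<open>G/D\<close>, does not exceed the size of an independent generating set: \<open>U\<close> may be replaced by an independent
generating set \<open>W\<close> of the quotient, and \<open>\<Omega>(|D|) - \<Omega>(|E|)\<close> is the size of \<open>\<D>\<close>. The set \<open>W\<close> is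
lifted into the supplement \<open>C\<close> of \<open>D\<close>, so that the maximal subgroup belonging to \<open>d \<in> \<D>\<close> contains
all other elements; dropping a lifted element is noticed in the quotient.\<close>

lemma (in group) supersolvable_indep_bound:
  assumes fin: "finite (carrier G)" and ss: "supersolvable G" and S: "S \<subseteq> carrier G"
    and ind: "indep_mod G (derived G (carrier G) \<inter> frattini G) S"
  obtains V where "V \<subseteq> carrier G" "indep_mod G {} V" "generate G V = carrier G" "card S \<le> card V"
proof -
  let ?D = "derived G (carrier G)" and ?Q = "G Mod derived G (carrier G)"
  let ?E = "?D \<inter> frattini G" and ?h = "\<lambda>x. ?D #> x"
  have normD: "?D \<lhd> G" using derived_is_normal[OF normal_self] .
  interpret D: normal ?D G by (rule normD)
  interpret h: group_hom G ?Q ?h by (rule D.coset_group_hom)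
  interpret Q: comm_group ?Q by (rule derived_quot_is_comm_group)
  have surj: "?h ` carrier G = carrier ?Q" by (simp add: carrier_FactGroup)
  have ker: "kernel G ?Q ?h = ?D" by (rule D.coset_kernel)
  have "subgroup ?E G" using D.is_subgroup frattini_subgroup by (rule subgroups_Inter_pair)
  then obtain U where U: "U \<subseteq> carrier ?Q" "indep_mod ?Q {} U"
    and cardU: "card S + Omega (card ?E) \<le> card U + Omega (card ?D)"
    using h.indep_mod_kernel_bound[OF fin S _ _ ind] ker by auto
  have "finite (carrier ?Q)" using fin surj by (metis finite_imageI)
  then obtain W where W: "W \<subseteq> carrier ?Q" "indep_mod ?Q {} W" "generate ?Q W = carrier ?Q"
    and UW: "card U \<le> card W"
    using Q.independent_generating_set_ge U by blast
  obtain \<D> C where \<D>: "\<D> \<subseteq> ?D" and C: "subgroup C G" "C <#> ?D = carrier G"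
    and card\<D>: "card \<D> + Omega (card ?E) = Omega (card ?D)"
    and gen: "?D \<subseteq> generate G (\<D> \<union> ?E)"
    and max: "\<forall>d\<in>\<D>. \<exists>M. maximal_subgroup M G \<and> C \<union> (\<D> - {d}) \<subseteq> M \<and> d \<notin> M"
    using independent_maximal_family[OF fin normD supersolvable_maximal_subgroup(2)[OF fin ss]
        supersolvable_maximal_subgroup(1)[OF fin ss]] .
  have Cc: "C \<subseteq> carrier G" using C(1) by (rule subgroup.subset)
  have "\<exists>c\<in>C. ?h c = w" if "w \<in> W" for w
  proof -
    have "w \<in> ?h ` carrier G" unfolding surj using that W(1) by blast
    then obtain g where g: "g \<in> carrier G" "w = ?h g" by blast
    have "g \<in> C <#> ?D" using g(1) by (simp only: C(2))
    then obtain c d where cd: "c \<in> C" "d \<in> ?D" "g = c \<otimes> d" unfolding set_mult_def by blast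
    have "d \<in> kernel G ?Q ?h" using cd(2) ker by simp
    then have "d \<in> carrier G" "?h d = \<one>\<^bsub>?Q\<^esub>" by (auto simp: kernel_def)
    moreover have "c \<in> carrier G" using cd(1) Cc by blast
    ultimately have "?h g = ?h c" using h.hom_mult[of c d] h.hom_closed[of c] h.H.r_one[of "?h c"] cd(3) by simp
    then show ?thesis using cd(1) g(2) by blast
  qed
  then obtain a where a: "\<And>w. w \<in> W \<Longrightarrow> a w \<in> C" "\<And>w. w \<in> W \<Longrightarrow> ?h (a w) = w" by metis
  let ?V = "\<D> \<union> a ` W"
  have \<D>c: "\<D> \<subseteq> carrier G" using \<D> D.subset by blast
  have Vc: "?V \<subseteq> carrier G" using \<D>c a(1) Cc by blast
  have h\<D>: "?h d = \<one>\<^bsub>?Q\<^esub>" if "d \<in> \<D>" for d using that \<D> ker by (auto simp: kernel_def)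
  have inja: "inj_on a W" using a(2) by (metis inj_onI)
  have disj: "\<D> \<inter> a ` W = {}" using max a(1) by blast
  have "indep_mod G {} ?V"
    unfolding indep_mod_def
  proof
    fix v assume v: "v \<in> ?V"
    then show "v \<notin> generate G ({} \<union> (?V - {v}))"
    proof
      assume "v \<in> \<D>"
      then obtain M where M: "maximal_subgroup M G" "C \<union> (\<D> - {v}) \<subseteq> M" "v \<notin> M" using max by blast
      then have "?V - {v} \<subseteq> M" using a(1) by blast
      then have "generate G (?V - {v}) \<subseteq> M"
        using M(1) by (intro generate_subgroup_incl) (auto simp: maximal_subgroup_def)
      then show ?thesis using M by auto
    next
      assume "v \<in> a ` W"
      then obtain w where w: "w \<in> W" "v = a w" by blast
      have "?h ` (?V - {v}) \<subseteq> generate ?Q (W - {w})"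
      proof (rule image_subsetI)
        fix x assume x: "x \<in> ?V - {v}"
        show "?h x \<in> generate ?Q (W - {w})"
        proof (cases "x \<in> \<D>")
          case True
          then show ?thesis using h\<D>[OF True] generate.one[of ?Q "W - {w}"] by metis
        next
          case False
          then obtain w' where "w' \<in> W" "x = a w'" using x by blast
          then show ?thesis using x w a(2) by (intro generate.incl) auto
        qed
      qed
      then have "generate ?Q (?h ` (?V - {v})) \<subseteq> generate ?Q (W - {w})"
        using W(1) by (intro h.H.generate_subgroup_incl h.H.generate_is_subgroup) auto
      moreover have "generate ?Q (?h ` (?V - {v})) = ?h ` generate G (?V - {v})"
        using Vc by (intro h.generate_img) blast
      moreover have "?h v \<notin> generate ?Q (W - {w})"
        using W(2) w a(2) by (auto simp: indep_mod_def)
      ultimately show ?thesis by auto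
    qed
  qed
  moreover have "generate G ?V = carrier G"
  proof (rule ccontr)
    assume "generate G ?V \<noteq> carrier G"
    then obtain M where M: "maximal_subgroup M G" "generate G ?V \<subseteq> M"
      using subgroup_le_maximal[OF fin generate_is_subgroup[OF Vc]] by blast
    have sg: "subgroup M G" and ne: "M \<noteq> carrier G" using M by (auto simp: maximal_subgroup_def)
    have VM: "?V \<subseteq> M" using M(2) generate.incl[of _ ?V G] by blast
    then have "\<D> \<union> ?E \<subseteq> M" using M(1) by (auto simp: mem_frattini_iff)
    then have DM: "?D \<subseteq> M" using gen sg generate_subgroup_incl by blast
    have "carrier ?Q \<subseteq> ?h ` M"
    proof -
      have "w \<in> ?h ` M" if "w \<in> W" for w
        using a(2)[OF that] VM that by (intro image_eqI[of w ?h "a w"]) auto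
      then have "W \<subseteq> ?h ` M" by blast
      then have "generate ?Q W \<subseteq> ?h ` M"
        using h.subgroup_img_is_subgroup[OF sg] by (rule h.H.generate_subgroup_incl)
      then show ?thesis by (simp only: W(3))
    qed
    then have "x \<in> M" if "x \<in> carrier G" for x
      using that DM unfolding surj[symmetric] by (intro h.mem_if_image_mem[OF sg]) (auto simp: ker)
    then have "carrier G \<subseteq> M" by blast
    then show False using ne subgroup.subset[OF sg] by blast
  qed
  moreover have "card S \<le> card ?V"
  proof -
    have "finite \<D>" "finite (a ` W)" using Vc fin by (auto intro: finite_subset)
    then have "card ?V = card \<D> + card W"
      using disj card_image[OF inja] by (simp add: card_Un_disjoint)
    then show ?thesis using cardU card\<D> UW by linarith
  qed
  ultimately show ?thesis using that Vc by blast
qed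

section \<open>Irredundant sequences and general position\<close>

lemma (in group) irredundant_iff:
  "irredundant G gs \<longleftrightarrow> distinct gs \<and> set gs \<subseteq> carrier G \<and> indep_mod G {} (set gs)"
proof (cases "distinct gs \<and> set gs \<subseteq> carrier G")
  case True
  then have dist: "distinct gs" and sub: "set gs \<subseteq> carrier G" by auto
  have others: "{gs ! j | j. j < length gs \<and> j \<noteq> i} = set gs - {gs ! i}" if "i < length gs" for i
    using that dist by (auto simp: in_set_conv_nth nth_eq_iff_index_eq)
  have "generate G (set gs - {x}) \<subset> generate G (set gs) \<longleftrightarrow> x \<notin> generate G (set gs - {x})"
    if x: "x \<in> set gs" for x
  proof
    assume *: "generate G (set gs - {x}) \<subset> generate G (set gs)"
    show "x \<notin> generate G (set gs - {x})"
    proof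
      assume "x \<in> generate G (set gs - {x})"
      then have "set gs \<subseteq> generate G (set gs - {x})" by (auto intro: generate.incl)
      then have "generate G (set gs) \<subseteq> generate G (set gs - {x})"
        using sub by (intro generate_subgroup_incl generate_is_subgroup) auto
      then show False using * by blast
    qed
  next
    assume "x \<notin> generate G (set gs - {x})"
    then show "generate G (set gs - {x}) \<subset> generate G (set gs)"
      using mono_generate[of "set gs - {x}" "set gs"] generate.incl[OF x, of G] by blast
  qed
  then show ?thesis
    using True others by (simp add: irredundant_def indep_mod_def all_set_conv_all_nth)
next
  case False
  then show ?thesis using irredundant_imp_distinct by (auto simp: irredundant_def)
qed

lemma (in group) finite_generating_lengths:
  assumes "finite (carrier G)"
  shows "finite {length gs | gs. irredundant G gs \<and> generating G gs}"
  by (rule finite_subset[OF _ finite_irredundant_lengths[OF assms]]) blast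

lemma (in group) card_le_m_max:
  assumes fin: "finite (carrier G)" and V: "V \<subseteq> carrier G" "indep_mod G {} V" "generate G V = carrier G"
  shows "card V \<le> m_max G"
proof -
  obtain gs where gs: "set gs = V" "distinct gs"
    using finite_distinct_list[OF finite_subset[OF V(1) fin]] by blast
  then have "irredundant G gs \<and> generating G gs" using V by (simp add: irredundant_iff generating_def)
  then show ?thesis
    unfolding m_max_def using finite_generating_lengths[OF fin] distinct_card[OF gs(2)]
    by (intro Max_ge) (auto simp: gs(1) intro!: exI[of _ gs])
qed

lemma (in group) m_max_attained:
  assumes "finite (carrier G)"
  obtains gs where "irredundant G gs" "generating G gs" "length gs = m_max G"
proof -
  have "m_max G \<in> {length gs | gs. irredundant G gs \<and> generating G gs}"
    unfolding m_max_def
    using finite_generating_lengths[OF assms] irredundant_generating_exists[OF assms]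
    by (intro Max_in) auto
  then show ?thesis using that by auto
qed

text \<open>For an irredundant generating sequence, the elements other than the \<open>i\<close>-th generate a proper
subgroup. A maximal subgroup \<open>H i\<close> above it misses the \<open>i\<close>-th element, which therefore witnesses
that omitting \<open>H i\<close> enlarges the intersection.\<close>

lemma (in group) m_max_le_MaxDim:
  assumes fin: "finite (carrier G)"
  shows "m_max G \<le> MaxDim G"
proof -
  obtain gs where irr: "irredundant G gs" and gen: "generating G gs" and len: "length gs = m_max G"
    using m_max_attained[OF fin] .
  have sub: "set gs \<subseteq> carrier G" using gen by (simp add: generating_def)
  let ?O = "\<lambda>i. {gs ! j | j. j < length gs \<and> j \<noteq> i}"
  have ex: "\<exists>M. maximal_subgroup M G \<and> ?O i \<subseteq> M" if i: "i < length gs" for i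
  proof -
    have sg: "subgroup (generate G (?O i)) G" using sub by (intro generate_is_subgroup) auto
    have ne: "generate G (?O i) \<noteq> carrier G"
      using irr gen i unfolding irredundant_def generating_def by blast
    obtain M where "maximal_subgroup M G" "generate G (?O i) \<subseteq> M"
      using subgroup_le_maximal[OF fin sg ne] .
    moreover have "?O i \<subseteq> generate G (?O i)" by (rule subsetI, rule generate.incl)
    ultimately show ?thesis by blast
  qed
  define H where "H i = (SOME M. maximal_subgroup M G \<and> ?O i \<subseteq> M)" for i
  have H: "maximal_subgroup (H i) G \<and> ?O i \<subseteq> H i" if "i < length gs" for i
    unfolding H_def using ex[OF that] by (rule someI_ex)
  have sg: "subgroup (H i) G" and ne: "H i \<noteq> carrier G" if "i < length gs" for i
    using H[OF that] by (simp_all add: maximal_subgroup_def)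
  have other: "gs ! j \<in> H i" if "i < length gs" "j < length gs" "j \<noteq> i" for i j
    using H[OF that(1)] that(2,3) by blast
  have own: "gs ! i \<notin> H i" if i: "i < length gs" for i
  proof
    assume "gs ! i \<in> H i"
    then have "gs ! j \<in> H i" if "j < length gs" for j using other[OF i that] by (cases "j = i") auto
    then have "set gs \<subseteq> H i" by (auto simp: in_set_conv_nth)
    then have "generate G (set gs) \<subseteq> H i" using sg[OF i] by (rule generate_subgroup_incl)
    then show False
      using gen ne[OF i] subgroup.subset[OF sg[OF i]] by (simp add: generating_def)
  qed
  have "general_position G {..<length gs} H"
    unfolding general_position_def
  proof (intro conjI ballI psubsetI)
    fix i assume "i \<in> {..<length gs}"
    then have i: "i < length gs" by simp
    then show "subgroup (H i) G" by (rule sg)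
    show "subgroup_Inter G (H ` {..<length gs}) \<subseteq> subgroup_Inter G (H ` ({..<length gs} - {i}))"
      by (auto simp: subgroup_Inter_def)
    have "gs ! i \<in> carrier G" using i sub by auto
    then have "gs ! i \<in> subgroup_Inter G (H ` ({..<length gs} - {i}))"
      using i other[OF _ i] by (simp add: subgroup_Inter_def)
    moreover have "gs ! i \<notin> subgroup_Inter G (H ` {..<length gs})"
      using i own[OF i] by (simp add: subgroup_Inter_def) blast
    ultimately show "subgroup_Inter G (H ` {..<length gs}) \<noteq> subgroup_Inter G (H ` ({..<length gs} - {i}))"
      by blast
  qed
  moreover have "\<forall>i<length gs. maximal_subgroup (H i) G" using H by blast
  ultimately have "length gs \<le> MaxDim G"
    unfolding MaxDim_def using finite_MaxDim_set[OF fin] by (intro Max_ge) blast+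
  then show ?thesis using len by simp
qed

text \<open>Pick \<open>g i\<close> in all \<open>H j\<close> with \<open>j \<noteq> i\<close> but not in \<open>H i\<close>. Then \<open>H i\<close> contains the other chosen elements
and the Frattini subgroup, so that \<open>g i\<close> is not generated by them.\<close>

lemma (in group) MaxDim_indep:
  assumes fin: "finite (carrier G)"
  obtains S where "S \<subseteq> carrier G" "indep_mod G (frattini G) S" "card S = MaxDim G"
proof -
  have "MaxDim G \<in> {n. \<exists>H :: nat \<Rightarrow> 'a set. (\<forall>i<n. maximal_subgroup (H i) G) \<and>
      general_position G {..<n} H}"
    unfolding MaxDim_def using finite_MaxDim_set[OF fin] zero_in_MaxDim_set by (intro Max_in) blast+
  then obtain H :: "nat \<Rightarrow> 'a set"
    where max: "\<And>i. i < MaxDim G \<Longrightarrow> maximal_subgroup (H i) G"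
      and gp: "general_position G {..<MaxDim G} H" by blast
  have "\<exists>g. g \<in> subgroup_Inter G (H ` ({..<MaxDim G} - {i})) \<and> g \<notin> H i" if "i < MaxDim G" for i
  proof -
    have "subgroup_Inter G (H ` {..<MaxDim G}) \<subset> subgroup_Inter G (H ` ({..<MaxDim G} - {i}))"
      using gp that by (simp add: general_position_def)
    then obtain g where g: "g \<in> subgroup_Inter G (H ` ({..<MaxDim G} - {i}))"
      "g \<notin> subgroup_Inter G (H ` {..<MaxDim G})" by blast
    then have "g \<notin> H i" by (auto simp: subgroup_Inter_def)
    then show ?thesis using g(1) by blast
  qed
  then obtain g where g: "\<And>i. i < MaxDim G \<Longrightarrow> g i \<in> subgroup_Inter G (H ` ({..<MaxDim G} - {i}))"
    and own: "\<And>i. i < MaxDim G \<Longrightarrow> g i \<notin> H i" by metis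
  have gc: "g i \<in> carrier G" if "i < MaxDim G" for i using g[OF that] by (simp add: subgroup_Inter_def)
  have other: "g i \<in> H j" if "i < MaxDim G" "j < MaxDim G" "i \<noteq> j" for i j
    using g[OF that(1)] that by (auto simp: subgroup_Inter_def)
  have inj: "inj_on g {..<MaxDim G}" using own other by (metis inj_onI lessThan_iff)
  have "indep_mod G (frattini G) (g ` {..<MaxDim G})"
    unfolding indep_mod_def
  proof clarsimp
    fix i assume i: "i < MaxDim G" and *: "g i \<in> generate G (frattini G \<union> (g ` {..<MaxDim G} - {g i}))"
    have "frattini G \<union> (g ` {..<MaxDim G} - {g i}) \<subseteq> H i"
      using max[OF i] other[OF _ i] by (auto simp: mem_frattini_iff)
    then have "generate G (frattini G \<union> (g ` {..<MaxDim G} - {g i})) \<subseteq> H i"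
      using max[OF i] by (intro generate_subgroup_incl) (auto simp: maximal_subgroup_def)
    then show False using * own[OF i] by blast
  qed
  then show ?thesis using that[of "g ` {..<MaxDim G}"] gc card_image[OF inj] by auto
qed

lemma (in group) indep_mod_antimono:
  assumes "E' \<subseteq> E" "indep_mod G E S"
  shows "indep_mod G E' S"
  unfolding indep_mod_def
proof
  fix s assume "s \<in> S"
  then have "s \<notin> generate G (E \<union> (S - {s}))" using assms(2) by (simp add: indep_mod_def)
  then show "s \<notin> generate G (E' \<union> (S - {s}))"
    using mono_generate[of "E' \<union> (S - {s})" "E \<union> (S - {s})"] assms(1) by blast
qed

theorem theorem25:
  fixes G :: "('a, 'b) monoid_scheme"
  assumes "group G" and "finite (carrier G)" and "supersolvable G"
  shows "(frattini G \<inter> derived G (carrier G) = {\<one>\<^bsub>G\<^esub>} \<longrightarrow> m_max G = i_max G)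
       \<and> MaxDim G = m_max G"
proof -
  interpret group G by fact
  note fin = assms(2)
  have bound: "card S \<le> m_max G"
    if S: "S \<subseteq> carrier G" "indep_mod G (derived G (carrier G) \<inter> frattini G) S" for S
  proof -
    obtain V where V: "V \<subseteq> carrier G" "indep_mod G {} V" "generate G V = carrier G" "card S \<le> card V"
      using supersolvable_indep_bound[OF fin assms(3) S] .
    then show ?thesis using card_le_m_max[OF fin V(1-3)] by linarith
  qed
  show ?thesis
  proof (intro conjI impI antisym)
    assume triv: "frattini G \<inter> derived G (carrier G) = {\<one>\<^bsub>G\<^esub>}"
    have finI: "finite {length gs | gs. irredundant G gs}" using fin by (rule finite_irredundant_lengths)
    show "m_max G \<le> i_max G"
    proof -
      obtain gs where "irredundant G gs" "generating G gs" "length gs = m_max G" using m_max_attained[OF fin] .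
      then have "m_max G \<in> {length gs | gs. irredundant G gs}"
        by (intro CollectI exI[of _ gs]) simp
      then show ?thesis unfolding i_max_def using finI by (intro Max_ge)
    qed
    have "i_max G \<in> {length gs | gs. irredundant G gs}"
      unfolding i_max_def using finI irredundant_Nil by (intro Max_in) blast+
    then obtain gs where gs: "irredundant G gs" "length gs = i_max G" by auto
    have "indep_mod G {\<one>\<^bsub>G\<^esub>} (set gs)"
      unfolding indep_mod_def
    proof
      fix s assume s: "s \<in> set gs"
      let ?K = "generate G (set gs - {s})"
      have "subgroup ?K G" using gs(1) by (intro generate_is_subgroup) (auto simp: irredundant_iff)
      then have "generate G ({\<one>\<^bsub>G\<^esub>} \<union> (set gs - {s})) \<subseteq> ?K"
        by (intro generate_subgroup_incl) (auto intro: generate.incl generate.one)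
      moreover have "s \<notin> ?K" using gs(1) s by (auto simp: irredundant_iff indep_mod_def)
      ultimately show "s \<notin> generate G ({\<one>\<^bsub>G\<^esub>} \<union> (set gs - {s}))" by blast
    qed
    then have "card (set gs) \<le> m_max G"
      using gs(1) triv by (intro bound) (auto simp: irredundant_iff Int_commute)
    then show "i_max G \<le> m_max G"
      using gs by (simp add: irredundant_iff distinct_card)
  next
    obtain S where S: "S \<subseteq> carrier G" "indep_mod G (frattini G) S" "card S = MaxDim G"
      using MaxDim_indep[OF fin] .
    have "indep_mod G (derived G (carrier G) \<inter> frattini G) S"
      using S(2) by (rule indep_mod_antimono[rotated]) simp
    then show "MaxDim G \<le> m_max G" using bound[OF S(1)] S(3) by simp
    show "m_max G \<le> MaxDim G" using fin by (rule m_max_le_MaxDim)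
  qed
qed

end
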